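(* The quadruple $(H_\ell(\tilde X),\, m_{RT},\, 1,\, \Delta_\epsilon)$ is an infinitesimal unitary bialgebra ($\epsilon$-unitary bialgebra).
   Context: Let $\mathbf{k}$ be a commutative ring with unit; linear maps and tensor products are over $\mathbf{k}$. For an associative algebra $A$, view $A\otimes A$ as an $A$-bimodule via $a\cdot(b\otimes c):=ab\otimes c$ and $(b\otimes c)\cdot a:=b\otimes ca$. An infinitesimal unitary bialgebra ($\epsilon$-unitary bialgebra) is a quadruple $(A,m,1,\Delta)$ where $(A,m,1)$ is a unitary associative algebra, $(A,\Delta)$ is a coassociative coalgebra (no counit required), and $\Delta(ab)=a\cdot\Delta(b)+\Delta(a)\cdot b$ for all $a,b\in A$. Let $X$ be a set, $\sigma\notin X$ a symbol, and $\tilde X:=X\sqcup\{\sigma\}$. Consider planar rooted trees whose vertices are decorated by elements of $\tilde X$ in such a way that elements of $X$ decorate leaves only (all internal vertices, and possibly some leaves, are decorated by $\sigma$; the vertex of a one-vertex tree counts as a leaf). Let $\mathcal{T}_\ell(\tilde X)$ be the set of such trees, including by convention the empty tree $1$. Let $\mathcal{F}_\ell(\tilde X)$ be the free monoid generated by the nonempty such trees (planar decorated rooted forests, with concatenation as product and $1$ as identity), and let $H_\ell(\tilde X):=\mathbf{k}\mathcal{F}_\ell(\tilde X)$ be the free $\mathbf{k}$-module on it, with the linearly extended concatenation product $m_{RT}$ and unit $1$. For $x\in\tilde X$, $\bullet_x$ is the one-vertex tree decorated by $x$. $B^+:H_\ell(\tilde X)\to H_\ell(\tilde X)$ is the linear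 grafting map with $B^+(1)=\bullet_\sigma$ that sends a forest to the tree obtained by grafting it onto a new root decorated by $\sigma$. Every nonempty tree in $\mathcal{T}_\ell(\tilde X)$ is either $\bullet_x$ with $x\in X$ or $B^+(\bar F)$ for a unique forest $\bar F\in\mathcal{F}_\ell(\tilde X)$. The linear map $\Delta_\epsilon:H_\ell(\tilde X)\to H_\ell(\tilde X)\otimes H_\ell(\tilde X)$ is defined recursively on forests by: $\Delta_\epsilon(1)=0$; $\Delta_\epsilon(\bullet_x)=1\otimes 1$ for $x\in X$; $\Delta_\epsilon(B^+(\bar F))=\bar F\otimes 1+(\mathrm{id}\otimes B^+)\Delta_\epsilon(\bar F)$ for $\bar F\in\mathcal{F}_\ell(\tilde X)$; and $\Delta_\epsilon(T_1T_2\cdots T_m)=T_1\cdot\Delta_\epsilon(T_2\cdots T_m)+\Delta_\epsilon(T_1)\cdot(T_2\cdots T_m)$ for nonempty trees $T_1,\dots,T_m\in\mathcal{T}_\ell(\tilde X)$, $m\ge 2$. *)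

theory Defs
  imports "HOL-Algebra.Module" "HOL-Algebra.AbelCoset"
begin

section \<open>Linear maps and free modules\<close>

definition linear_map ::
  "('r, 'z) ring_scheme \<Rightarrow> ('r, 'a, 'm) module_scheme \<Rightarrow> ('r, 'b, 'n) module_scheme \<Rightarrow> ('a \<Rightarrow> 'b) \<Rightarrow> bool"
  where "linear_map R M N f \<longleftrightarrow>
    f \<in> carrier M \<rightarrow> carrier N \<and>
    (\<forall>x \<in> carrier M. \<forall>y \<in> carrier M. f (x \<oplus>\<^bsub>M\<^esub> y) = f x \<oplus>\<^bsub>N\<^esub> f y) \<and>
    (\<forall>r \<in> carrier R. \<forall>x \<in> carrier M. f (r \<odot>\<^bsub>M\<^esub> x) = r \<odot>\<^bsub>N\<^esub> f x)"

text \<open>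
  The record type \<^typ>\<open>('r, 'a) module\<close> extends \<^typ>\<open>'a ring\<close>, so it also has fields for a product
  and its unit. The predicate \<^const>\<open>module\<close> does not constrain them; they are left
  unspecified wherever only a module is meant. Elements of the free module on \<open>B\<close> are the finitely
  supported functions vanishing outside \<open>B\<close>.
\<close>

definition free_module :: "('r, 'z) ring_scheme \<Rightarrow> 'b set \<Rightarrow> ('r, 'b \<Rightarrow> 'r) module"
  where "free_module R B =
    \<lparr>carrier = {f. (\<forall>b \<in> B. f b \<in> carrier R) \<and> (\<forall>b. b \<notin> B \<longrightarrow> f b = \<zero>\<^bsub>R\<^esub>) \<and> finite {b. f b \<noteq> \<zero>\<^bsub>R\<^esub>}},
     mult = undefined, one = undefined,
     zero = (\<lambda>_. \<zero>\<^bsub>R\<^esub>),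
     add = (\<lambda>f g b. f b \<oplus>\<^bsub>R\<^esub> g b),
     smult = (\<lambda>r f b. r \<otimes>\<^bsub>R\<^esub> f b)\<rparr>"

definition basis_elt :: "('r, 'z) ring_scheme \<Rightarrow> 'b \<Rightarrow> 'b \<Rightarrow> 'r"
  where "basis_elt R b = (\<lambda>c. if c = b then \<one>\<^bsub>R\<^esub> else \<zero>\<^bsub>R\<^esub>)"

definition linear_ext ::
  "('r, 'z) ring_scheme \<Rightarrow> ('r, 'a, 'm) module_scheme \<Rightarrow> ('b \<Rightarrow> 'a) \<Rightarrow> ('b \<Rightarrow> 'r) \<Rightarrow> 'a"
  where "linear_ext R M \<phi> f = (\<Oplus>\<^bsub>M\<^esub>b \<in> {b. f b \<noteq> \<zero>\<^bsub>R\<^esub>}. f b \<odot>\<^bsub>M\<^esub> \<phi> b)"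

section \<open>Tensor products\<close>

definition quotient_module ::
  "('r, 'a, 'm) module_scheme \<Rightarrow> 'a set \<Rightarrow> ('r, 'a set) module"
  where "quotient_module M N =
    \<lparr>carrier = a_rcosets\<^bsub>M\<^esub> N,
     mult = undefined, one = undefined,
     zero = N,
     add = set_add M,
     smult = (\<lambda>r C. \<Union>x \<in> C. N +>\<^bsub>M\<^esub> (r \<odot>\<^bsub>M\<^esub> x))\<rparr>"

definition submodule_generated ::
  "('r, 'z) ring_scheme \<Rightarrow> ('r, 'a, 'm) module_scheme \<Rightarrow> 'a set \<Rightarrow> 'a set"
  where "submodule_generated R M S = \<Inter>{N. submodule N R M \<and> S \<subseteq> N}"

type_synonym ('a, 'b, 'r) tens = "('a \<times> 'b \<Rightarrow> 'r) set"

definition tensor_free ::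
  "('r, 'z) ring_scheme \<Rightarrow> ('r, 'a, 'm) module_scheme \<Rightarrow> ('r, 'b, 'n) module_scheme
    \<Rightarrow> ('r, 'a \<times> 'b \<Rightarrow> 'r) module"
  where "tensor_free R M N = free_module R (carrier M \<times> carrier N)"

definition tensor_relators ::
  "('r, 'z) ring_scheme \<Rightarrow> ('r, 'a, 'm) module_scheme \<Rightarrow> ('r, 'b, 'n) module_scheme
    \<Rightarrow> ('a \<times> 'b \<Rightarrow> 'r) set"
  where "tensor_relators R M N =
    (let F = tensor_free R M N; e = (\<lambda>m n. basis_elt R (m, n)) in
      {e (m \<oplus>\<^bsub>M\<^esub> m') n \<ominus>\<^bsub>F\<^esub> (e m n \<oplus>\<^bsub>F\<^esub> e m' n) | m m' n.
         m \<in> carrier M \<and> m' \<in> carrier M \<and> n \<in> carrier N}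
    \<union> {e m (n \<oplus>\<^bsub>N\<^esub> n') \<ominus>\<^bsub>F\<^esub> (e m n \<oplus>\<^bsub>F\<^esub> e m n') | m n n'.
         m \<in> carrier M \<and> n \<in> carrier N \<and> n' \<in> carrier N}
    \<union> {e (r \<odot>\<^bsub>M\<^esub> m) n \<ominus>\<^bsub>F\<^esub> (r \<odot>\<^bsub>F\<^esub> e m n) | r m n.
         r \<in> carrier R \<and> m \<in> carrier M \<and> n \<in> carrier N}
    \<union> {e m (r \<odot>\<^bsub>N\<^esub> n) \<ominus>\<^bsub>F\<^esub> (r \<odot>\<^bsub>F\<^esub> e m n) | r m n.
         r \<in> carrier R \<and> m \<in> carrier M \<and> n \<in> carrier N})"

definition tensor_null ::
  "('r, 'z) ring_scheme \<Rightarrow> ('r, 'a, 'm) module_scheme \<Rightarrow> ('r, 'b, 'n) module_scheme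
    \<Rightarrow> ('a \<times> 'b \<Rightarrow> 'r) set"
  where "tensor_null R M N = submodule_generated R (tensor_free R M N) (tensor_relators R M N)"

definition tensor ::
  "('r, 'z) ring_scheme \<Rightarrow> ('r, 'a, 'm) module_scheme \<Rightarrow> ('r, 'b, 'n) module_scheme
    \<Rightarrow> ('r, ('a, 'b, 'r) tens) module"
  where "tensor R M N = quotient_module (tensor_free R M N) (tensor_null R M N)"

definition pure_tensor ::
  "('r, 'z) ring_scheme \<Rightarrow> ('r, 'a, 'm) module_scheme \<Rightarrow> ('r, 'b, 'n) module_scheme
    \<Rightarrow> 'a \<Rightarrow> 'b \<Rightarrow> ('a, 'b, 'r) tens"
  where "pure_tensor R M N m n = tensor_null R M N +>\<^bsub>tensor_free R M N\<^esub> basis_elt R (m, n)"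

text \<open>
  The linear map out of a tensor product into \<open>P\<close> that sends \<open>m \<otimes> n\<close> to \<open>\<beta> m n\<close>, computed on a
  representative of the coset. It is used only for \<open>\<beta>\<close> bilinear, when the value does not
  depend on the representative.
\<close>

definition tensor_lift ::
  "('r, 'z) ring_scheme \<Rightarrow> ('r, 'p, 'q) module_scheme \<Rightarrow> ('a \<Rightarrow> 'b \<Rightarrow> 'p) \<Rightarrow> ('a, 'b, 'r) tens \<Rightarrow> 'p"
  where "tensor_lift R P \<beta> C = linear_ext R P (\<lambda>(m, n). \<beta> m n) (SOME f. f \<in> C)"

text \<open>\<open>f \<otimes> g\<close>, where \<open>P\<close> and \<open>Q\<close> are the codomains of \<open>f\<close> and \<open>g\<close>.\<close>

definition tensor_map ::
  "('r, 'z) ring_scheme \<Rightarrow> ('r, 'p, 'm) module_scheme \<Rightarrow> ('r, 'q, 'n) module_scheme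
    \<Rightarrow> ('a \<Rightarrow> 'p) \<Rightarrow> ('b \<Rightarrow> 'q) \<Rightarrow> ('a, 'b, 'r) tens \<Rightarrow> ('p, 'q, 'r) tens"
  where "tensor_map R P Q f g = tensor_lift R (tensor R P Q) (\<lambda>m n. pure_tensor R P Q (f m) (g n))"

text \<open>The canonical map from \<open>(L \<otimes> M) \<otimes> N\<close> to \<open>L \<otimes> (M \<otimes> N)\<close>.\<close>

definition tensor_assoc ::
  "('r, 'z) ring_scheme \<Rightarrow> ('r, 'a, 'l) module_scheme \<Rightarrow> ('r, 'b, 'm) module_scheme
    \<Rightarrow> ('r, 'c, 'n) module_scheme
    \<Rightarrow> (('a, 'b, 'r) tens, 'c, 'r) tens \<Rightarrow> ('a, ('b, 'c, 'r) tens, 'r) tens"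
  where "tensor_assoc R L M N =
    (let P = tensor R L (tensor R M N) in
      tensor_lift R P (\<lambda>t z. tensor_lift R P
        (\<lambda>x y. pure_tensor R L (tensor R M N) x (pure_tensor R M N y z)) t))"

section \<open>Infinitesimal unitary bialgebras\<close>

text \<open>
  The library locale \<^locale>\<open>algebra\<close> requires a commutative product, hence the separate notion here.
\<close>

locale unitary_algebra = module R A + ring A for R (structure) and A (structure) +
  assumes smult_mult_left:
      "\<lbrakk>r \<in> carrier R; a \<in> carrier A; b \<in> carrier A\<rbrakk>
        \<Longrightarrow> (r \<odot>\<^bsub>A\<^esub> a) \<otimes>\<^bsub>A\<^esub> b = r \<odot>\<^bsub>A\<^esub> (a \<otimes>\<^bsub>A\<^esub> b)"
    and smult_mult_right:
      "\<lbrakk>r \<in> carrier R; a \<in> carrier A; b \<in> carrier A\<rbrakk>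
        \<Longrightarrow> a \<otimes>\<^bsub>A\<^esub> (r \<odot>\<^bsub>A\<^esub> b) = r \<odot>\<^bsub>A\<^esub> (a \<otimes>\<^bsub>A\<^esub> b)"

locale coassociative_coalgebra = module R C for R (structure) and C (structure) +
  fixes \<Delta>
  assumes coproduct_linear: "linear_map R C (tensor R C C) \<Delta>"
    and coassoc: "c \<in> carrier C \<Longrightarrow>
      tensor_assoc R C C C (tensor_map R (tensor R C C) C \<Delta> (\<lambda>x. x) (\<Delta> c))
        = tensor_map R C (tensor R C C) (\<lambda>x. x) \<Delta> (\<Delta> c)"

text \<open>The \<open>A\<close>-bimodule structure \<open>a \<cdot> (b \<otimes> c) = a b \<otimes> c\<close>, \<open>(b \<otimes> c) \<cdot> a = b \<otimes> c a\<close>.\<close>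

definition left_action ::
  "('r, 'z) ring_scheme \<Rightarrow> ('r, 'a, 'm) module_scheme \<Rightarrow> 'a \<Rightarrow> ('a, 'a, 'r) tens \<Rightarrow> ('a, 'a, 'r) tens"
  where "left_action R A a = tensor_map R A A (\<lambda>b. a \<otimes>\<^bsub>A\<^esub> b) (\<lambda>c. c)"

definition right_action ::
  "('r, 'z) ring_scheme \<Rightarrow> ('r, 'a, 'm) module_scheme \<Rightarrow> ('a, 'a, 'r) tens \<Rightarrow> 'a \<Rightarrow> ('a, 'a, 'r) tens"
  where "right_action R A t a = tensor_map R A A (\<lambda>b. b) (\<lambda>c. c \<otimes>\<^bsub>A\<^esub> a) t"

locale infinitesimal_unitary_bialgebra =
  unitary_algebra R A + coassociative_coalgebra R A \<Delta>
  for R (structure) and A (structure) and \<Delta> +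
  assumes coproduct_mult: "\<lbrakk>a \<in> carrier A; b \<in> carrier A\<rbrakk> \<Longrightarrow>
    \<Delta> (a \<otimes>\<^bsub>A\<^esub> b) = left_action R A a (\<Delta> b) \<oplus>\<^bsub>tensor R A A\<^esub> right_action R A (\<Delta> a) b"

section \<open>Decorated planar rooted forests\<close>

datatype 'd ptree = Node 'd "'d ptree list"

text \<open>
  The nonempty trees in \<open>\<T>\<^sub>\<ell>(X \<union> {\<sigma>})\<close>. The empty tree is the empty forest \<open>[]\<close>.
\<close>

fun leaf_tree :: "'d set \<Rightarrow> 'd \<Rightarrow> 'd ptree \<Rightarrow> bool"
  where "leaf_tree X \<sigma> (Node d ts) \<longleftrightarrow>
    (d = \<sigma> \<or> d \<in> X \<and> ts = []) \<and> (\<forall>t \<in> set ts. leaf_tree X \<sigma> t)"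

definition leaf_forests :: "'d set \<Rightarrow> 'd \<Rightarrow> 'd ptree list set"
  where "leaf_forests X \<sigma> = lists {t. leaf_tree X \<sigma> t}"

definition H_leaf :: "('r, 'z) ring_scheme \<Rightarrow> 'd set \<Rightarrow> 'd \<Rightarrow> ('r, 'd ptree list \<Rightarrow> 'r) module"
  where "H_leaf R X \<sigma> =
    (let M = free_module R (leaf_forests X \<sigma>) in
      M\<lparr>mult := (\<lambda>f g. linear_ext R M (\<lambda>u. linear_ext R M (\<lambda>v. basis_elt R (u @ v)) g) f),
        one := basis_elt R []\<rparr>)"

definition graft ::
  "('r, 'z) ring_scheme \<Rightarrow> 'd set \<Rightarrow> 'd \<Rightarrow> ('d ptree list \<Rightarrow> 'r) \<Rightarrow> ('d ptree list \<Rightarrow> 'r)"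
  where "graft R X \<sigma> = linear_ext R (H_leaf R X \<sigma>) (\<lambda>F. basis_elt R [Node \<sigma> F])"

text \<open>
  Note that the tree \<open>Node \<sigma> ts\<close> is the grafting of the forest \<open>ts\<close>, also for \<open>ts = []\<close>.
\<close>

fun coproduct_forest ::
  "('r, 'z) ring_scheme \<Rightarrow> 'd set \<Rightarrow> 'd \<Rightarrow> 'd ptree list
    \<Rightarrow> ('d ptree list \<Rightarrow> 'r, 'd ptree list \<Rightarrow> 'r, 'r) tens"
  where
    "coproduct_forest R X \<sigma> [] = \<zero>\<^bsub>tensor R (H_leaf R X \<sigma>) (H_leaf R X \<sigma>)\<^esub>"
  | "coproduct_forest R X \<sigma> [Node d ts] =
      (let H = H_leaf R X \<sigma> in
        if d \<in> X then pure_tensor R H H \<one>\<^bsub>H\<^esub> \<one>\<^bsub>H\<^esub>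
        else pure_tensor R H H (basis_elt R ts) \<one>\<^bsub>H\<^esub>
          \<oplus>\<^bsub>tensor R H H\<^esub> tensor_map R H H (\<lambda>f. f) (graft R X \<sigma>) (coproduct_forest R X \<sigma> ts))"
  | "coproduct_forest R X \<sigma> (T # T' # Ts) =
      (let H = H_leaf R X \<sigma> in
        left_action R H (basis_elt R [T]) (coproduct_forest R X \<sigma> (T' # Ts))
        \<oplus>\<^bsub>tensor R H H\<^esub> right_action R H (coproduct_forest R X \<sigma> [T]) (basis_elt R (T' # Ts)))"

definition coproduct_eps ::
  "('r, 'z) ring_scheme \<Rightarrow> 'd set \<Rightarrow> 'd \<Rightarrow> ('d ptree list \<Rightarrow> 'r)
    \<Rightarrow> ('d ptree list \<Rightarrow> 'r, 'd ptree list \<Rightarrow> 'r, 'r) tens"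
  where "coproduct_eps R X \<sigma> =
    linear_ext R (tensor R (H_leaf R X \<sigma>) (H_leaf R X \<sigma>)) (coproduct_forest R X \<sigma>)"

end

theory Submission
  imports Defs
begin

text \<open>
  On the concatenation algebra, \<open>\<Delta>\<close> is a derivation because it is one on concatenations of forests.
  For a derivation the coassociativity defect behaves well under products: with
  \<open>(u \<otimes> v) \<star> (x \<otimes> y) = u \<otimes> v x \<otimes> y\<close>,
  both \<open>(\<Delta> \<otimes> id) \<Delta> (a b)\<close> and \<open>(id \<otimes> \<Delta>) \<Delta> (a b)\<close> contain the mixed term \<open>\<Delta> a \<star> \<Delta> b\<close>,
  and the remaining terms are the iterated coproducts of \<open>b\<close> and \<open>a\<close> acted on by \<open>a\<close> and \<open>b\<close>.
  So the elements where coassociativity holds are closed under products; the cocycle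
  equation \<open>\<Delta> (B a) = a \<otimes> 1 + (id \<otimes> B) (\<Delta> a)\<close> together with \<open>\<Delta> 1 = 0\<close> makes them closed under
  grafting too, and induction on forests reaches the whole basis.
\<close>

section \<open>Linear and bilinear maps\<close>

text \<open>A tensor is a coset of formal sums, and \<open>tensor_lift\<close> evaluates it on an
  arbitrarily chosen representative, so a map out of a tensor product can be computed only once it
  is known to come from a bilinear map. The linear algebra therefore aims at two tools: linear maps
  out of a tensor product with known values on pure tensors, and an induction over tensors whose
  only cases are pure tensors and sums. Both iterated coproducts are compared in
  \<open>A \<otimes> (A \<otimes> A)\<close>; only the left one has to be transported there by the
  associator. Coassociativity is treated as a property of single elements, so that the closure steps
  can be stated in an abstract algebra, without forests. The grafting step needs the cocycle
  equation on the whole algebra, not just on a basis: it is applied to the second factors of the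
  pure tensors that make up \<open>\<Delta> a\<close>, and these are arbitrary elements.\<close>

lemma linear_mapI:
  assumes "\<And>x. x \<in> carrier M \<Longrightarrow> f x \<in> carrier N"
    and "\<And>x y. x \<in> carrier M \<Longrightarrow> y \<in> carrier M \<Longrightarrow> f (x \<oplus>\<^bsub>M\<^esub> y) = f x \<oplus>\<^bsub>N\<^esub> f y"
    and "\<And>r x. r \<in> carrier R \<Longrightarrow> x \<in> carrier M \<Longrightarrow> f (r \<odot>\<^bsub>M\<^esub> x) = r \<odot>\<^bsub>N\<^esub> f x"
  shows "linear_map R M N f"
  using assms by (auto simp: linear_map_def)

lemma linear_map_closed: "linear_map R M N f \<Longrightarrow> x \<in> carrier M \<Longrightarrow> f x \<in> carrier N"
  by (auto simp: linear_map_def)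

lemma linear_map_add:
  "linear_map R M N f \<Longrightarrow> x \<in> carrier M \<Longrightarrow> y \<in> carrier M \<Longrightarrow> f (x \<oplus>\<^bsub>M\<^esub> y) = f x \<oplus>\<^bsub>N\<^esub> f y"
  by (auto simp: linear_map_def)

lemma linear_map_smult:
  "linear_map R M N f \<Longrightarrow> r \<in> carrier R \<Longrightarrow> x \<in> carrier M \<Longrightarrow> f (r \<odot>\<^bsub>M\<^esub> x) = r \<odot>\<^bsub>N\<^esub> f x"
  by (auto simp: linear_map_def)

lemma linear_map_zero:
  assumes "module R M" "module R N" "linear_map R M N f"
  shows "f \<zero>\<^bsub>M\<^esub> = \<zero>\<^bsub>N\<^esub>"
proof -
  interpret M: module R M by fact
  interpret N: module R N by fact
  have "f (\<zero>\<^bsub>R\<^esub> \<odot>\<^bsub>M\<^esub> \<zero>\<^bsub>M\<^esub>) = \<zero>\<^bsub>R\<^esub> \<odot>\<^bsub>N\<^esub> f \<zero>\<^bsub>M\<^esub>"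
    by (rule linear_map_smult[OF assms(3)]) auto
  then show ?thesis
    using linear_map_closed[OF assms(3), of "\<zero>\<^bsub>M\<^esub>"] by simp
qed

lemma linear_map_a_inv:
  assumes "module R M" "module R N" "linear_map R M N f" "x \<in> carrier M"
  shows "f (\<ominus>\<^bsub>M\<^esub> x) = \<ominus>\<^bsub>N\<^esub> f x"
proof -
  interpret M: module R M by fact
  interpret N: module R N by fact
  note cl = linear_map_closed[OF assms(3)]
  have "f x \<oplus>\<^bsub>N\<^esub> f (\<ominus>\<^bsub>M\<^esub> x) = \<zero>\<^bsub>N\<^esub>"
    using linear_map_add[OF assms(3), of x "\<ominus>\<^bsub>M\<^esub> x"] linear_map_zero[OF assms(1-3)] assms(4)
    by (simp add: M.r_neg)
  then show ?thesis
    using N.minus_equality[of "f (\<ominus>\<^bsub>M\<^esub> x)" "f x"] cl assms(4) by (simp add: N.a_comm)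
qed

lemma linear_map_minus:
  assumes "module R M" "module R N" "linear_map R M N f" "x \<in> carrier M" "y \<in> carrier M"
  shows "f (x \<ominus>\<^bsub>M\<^esub> y) = f x \<ominus>\<^bsub>N\<^esub> f y"
proof -
  interpret M: module R M by fact
  show ?thesis
    using assms linear_map_a_inv[OF assms(1-3)] linear_map_add[OF assms(3)]
    by (simp add: a_minus_def)
qed

text \<open>Closed forms of the maps below hold only on carriers, so they cannot be rewritten under
  a lambda; this congruence replaces such a rewriting.\<close>

lemma linear_map_cong:
  assumes "module R M" "\<And>x. x \<in> carrier M \<Longrightarrow> f x = g x"
  shows "linear_map R M N f \<longleftrightarrow> linear_map R M N g"
proof -
  interpret M: module R M by fact
  show ?thesis using assms(2) by (simp add: linear_map_def Pi_def)
qed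

lemma linear_map_id: "linear_map R M M (\<lambda>x. x)"
  by (simp add: linear_map_def)

lemma linear_map_comp:
  "linear_map R M N f \<Longrightarrow> linear_map R N P g \<Longrightarrow> linear_map R M P (\<lambda>x. g (f x))"
  by (simp add: linear_map_def Pi_def)

lemma linear_map_const_zero:
  assumes "module R N"
  shows "linear_map R M N (\<lambda>_. \<zero>\<^bsub>N\<^esub>)"
proof -
  interpret N: module R N by fact
  show ?thesis by (simp add: linear_map_def)
qed

lemma linear_map_plus:
  assumes "module R N" "linear_map R M N f" "linear_map R M N g"
  shows "linear_map R M N (\<lambda>x. f x \<oplus>\<^bsub>N\<^esub> g x)"
proof -
  interpret N: module R N by fact
  note [simp] = assms(2,3)[THEN linear_map_closed] assms(2,3)[THEN linear_map_add]
    assms(2,3)[THEN linear_map_smult]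
  show ?thesis
    by (rule linear_mapI) (simp_all add: N.a_ac N.smult_r_distr)
qed

lemma linear_map_scale:
  assumes "module R N" "linear_map R M N f" "r \<in> carrier R"
  shows "linear_map R M N (\<lambda>x. r \<odot>\<^bsub>N\<^esub> f x)"
proof -
  interpret N: module R N by fact
  note [simp] = assms(2)[THEN linear_map_closed] assms(2)[THEN linear_map_add]
    assms(2)[THEN linear_map_smult] assms(3)
  show ?thesis
  proof (rule linear_mapI)
    \<comment> \<open>Multiplication by \<open>r\<close> respects the scalar \<open>s\<close>
      because \<open>R\<close> is commutative.\<close>
    fix s x assume s: "s \<in> carrier R" and x: "x \<in> carrier M"
    show "r \<odot>\<^bsub>N\<^esub> f (s \<odot>\<^bsub>M\<^esub> x) = s \<odot>\<^bsub>N\<^esub> (r \<odot>\<^bsub>N\<^esub> f x)"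
      using s x by (simp add: N.smult_assoc1[symmetric] N.R.m_comm)
  qed (simp_all add: N.smult_r_distr)
qed

definition bilinear_map ::
  "('r, 'z) ring_scheme \<Rightarrow> ('r, 'a, 'm) module_scheme \<Rightarrow> ('r, 'b, 'n) module_scheme
    \<Rightarrow> ('r, 'c, 'p) module_scheme \<Rightarrow> ('a \<Rightarrow> 'b \<Rightarrow> 'c) \<Rightarrow> bool"
  where "bilinear_map R M N P \<beta> \<longleftrightarrow>
    (\<forall>n \<in> carrier N. linear_map R M P (\<lambda>m. \<beta> m n)) \<and> (\<forall>m \<in> carrier M. linear_map R N P (\<beta> m))"

lemma bilinear_mapI:
  assumes "\<And>n. n \<in> carrier N \<Longrightarrow> linear_map R M P (\<lambda>m. \<beta> m n)"
    and "\<And>m. m \<in> carrier M \<Longrightarrow> linear_map R N P (\<lambda>n. \<beta> m n)"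
  shows "bilinear_map R M N P \<beta>"
  using assms by (simp add: bilinear_map_def)

lemma bilinear_map_left: "bilinear_map R M N P \<beta> \<Longrightarrow> n \<in> carrier N \<Longrightarrow> linear_map R M P (\<lambda>m. \<beta> m n)"
  and bilinear_map_right: "bilinear_map R M N P \<beta> \<Longrightarrow> m \<in> carrier M \<Longrightarrow> linear_map R N P (\<beta> m)"
  by (auto simp: bilinear_map_def)

lemma bilinear_map_closed:
  "bilinear_map R M N P \<beta> \<Longrightarrow> m \<in> carrier M \<Longrightarrow> n \<in> carrier N \<Longrightarrow> \<beta> m n \<in> carrier P"
  using bilinear_map_right linear_map_closed by fast

lemma bilinear_map_comp:
  assumes "bilinear_map R P Q S \<beta>" "linear_map R M P f" "linear_map R N Q g"
  shows "bilinear_map R M N S (\<lambda>m n. \<beta> (f m) (g n))"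
proof (rule bilinear_mapI)
  show "linear_map R M S (\<lambda>m. \<beta> (f m) (g n))" if "n \<in> carrier N" for n
    using linear_map_comp[OF assms(2) bilinear_map_left[OF assms(1)]]
      linear_map_closed[OF assms(3) that] by blast
  show "linear_map R N S (\<lambda>n. \<beta> (f m) (g n))" if "m \<in> carrier M" for m
    using linear_map_comp[OF assms(3) bilinear_map_right[OF assms(1)]]
      linear_map_closed[OF assms(2) that] by blast
qed

lemma bilinear_map_postcomp:
  assumes "bilinear_map R M N P \<beta>" "linear_map R P Q f"
  shows "bilinear_map R M N Q (\<lambda>m n. f (\<beta> m n))"
  using linear_map_comp[OF bilinear_map_left[OF assms(1)] assms(2)]
    linear_map_comp[OF bilinear_map_right[OF assms(1)] assms(2)]
  by (intro bilinear_mapI) auto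

section \<open>Free modules\<close>

lemma carrier_free_module:
  "f \<in> carrier (free_module R B) \<longleftrightarrow>
    (\<forall>b \<in> B. f b \<in> carrier R) \<and> (\<forall>b. b \<notin> B \<longrightarrow> f b = \<zero>\<^bsub>R\<^esub>) \<and> finite {b. f b \<noteq> \<zero>\<^bsub>R\<^esub>}"
  and zero_free_module: "\<zero>\<^bsub>free_module R B\<^esub> = (\<lambda>_. \<zero>\<^bsub>R\<^esub>)"
  and add_free_module: "f \<oplus>\<^bsub>free_module R B\<^esub> g = (\<lambda>b. f b \<oplus>\<^bsub>R\<^esub> g b)"
  and smult_free_module: "r \<odot>\<^bsub>free_module R B\<^esub> f = (\<lambda>b. r \<otimes>\<^bsub>R\<^esub> f b)"
  by (simp_all add: free_module_def)

lemma free_module_apply_closed: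
  assumes "cring R" "f \<in> carrier (free_module R B)"
  shows "f b \<in> carrier R"
proof -
  interpret cring R by fact
  show ?thesis using assms(2) by (cases "b \<in> B") (auto simp: carrier_free_module)
qed

lemma module_free_module:
  assumes "cring R"
  shows "module R (free_module R B)"
proof -
  interpret cring R by fact
  let ?F = "free_module R B"
  note [simp] = free_module_apply_closed[OF assms, where B = B]
  have add: "f \<oplus>\<^bsub>?F\<^esub> g \<in> carrier ?F" if f: "f \<in> carrier ?F" and g: "g \<in> carrier ?F" for f g
  proof -
    have "{b. f b \<oplus>\<^bsub>R\<^esub> g b \<noteq> \<zero>\<^bsub>R\<^esub>} \<subseteq> {b. f b \<noteq> \<zero>\<^bsub>R\<^esub>} \<union> {b. g b \<noteq> \<zero>\<^bsub>R\<^esub>}" by auto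
    then have "finite {b. f b \<oplus>\<^bsub>R\<^esub> g b \<noteq> \<zero>\<^bsub>R\<^esub>}"
      by (rule finite_subset) (use f g in \<open>auto simp: carrier_free_module\<close>)
    then show ?thesis using f g by (auto simp: carrier_free_module add_free_module)
  qed
  have smult: "r \<odot>\<^bsub>?F\<^esub> f \<in> carrier ?F" if r: "r \<in> carrier R" and f: "f \<in> carrier ?F" for r f
  proof -
    have "{b. r \<otimes>\<^bsub>R\<^esub> f b \<noteq> \<zero>\<^bsub>R\<^esub>} \<subseteq> {b. f b \<noteq> \<zero>\<^bsub>R\<^esub>}" using r by auto
    then have "finite {b. r \<otimes>\<^bsub>R\<^esub> f b \<noteq> \<zero>\<^bsub>R\<^esub>}"
      by (rule finite_subset) (use f in \<open>auto simp: carrier_free_module\<close>)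
    then show ?thesis using r f by (auto simp: carrier_free_module smult_free_module)
  qed
  have zero: "\<zero>\<^bsub>?F\<^esub> \<in> carrier ?F" by (simp add: carrier_free_module zero_free_module)
  show ?thesis
  proof (rule moduleI[OF assms])
    show "abelian_group ?F"
    proof (rule abelian_groupI)
      \<comment> \<open>The additive inverse is taken to be \<open>-1\<close> times
        \<open>f\<close>, so that its finite support comes from closure under scalars.\<close>
      fix f assume f: "f \<in> carrier ?F"
      have "(\<ominus>\<^bsub>R\<^esub> \<one>\<^bsub>R\<^esub>) \<odot>\<^bsub>?F\<^esub> f \<in> carrier ?F" using smult f by simp
      moreover have "(\<ominus>\<^bsub>R\<^esub> \<one>\<^bsub>R\<^esub>) \<odot>\<^bsub>?F\<^esub> f \<oplus>\<^bsub>?F\<^esub> f = \<zero>\<^bsub>?F\<^esub>"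
        using f by (simp add: smult_free_module add_free_module zero_free_module l_minus l_neg)
      ultimately show "\<exists>g\<in>carrier ?F. g \<oplus>\<^bsub>?F\<^esub> f = \<zero>\<^bsub>?F\<^esub>" by blast
    qed (use add zero in \<open>auto simp: add_free_module zero_free_module a_ac\<close>)
  qed (use smult in \<open>auto simp: add_free_module smult_free_module l_distr r_distr m_assoc\<close>)
qed

lemma basis_elt_closed:
  assumes "cring R" "b \<in> B"
  shows "basis_elt R b \<in> carrier (free_module R B)"
proof -
  interpret cring R by fact
  have "finite {c. basis_elt R b c \<noteq> \<zero>\<^bsub>R\<^esub>}"
    by (rule finite_subset[of _ "{b}"]) (auto simp: basis_elt_def)
  then show ?thesis using assms(2) by (auto simp: carrier_free_module basis_elt_def)
qed

text \<open>A finitely supported function is a finite sum of multiples of basis elements; the points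
  of the support are split off one at a time.\<close>

lemma free_module_induct [consumes 2, case_names zero basis add]:
  assumes "cring R" "f \<in> carrier (free_module R B)"
    and zero: "Q \<zero>\<^bsub>free_module R B\<^esub>"
    and basis: "\<And>r b. r \<in> carrier R \<Longrightarrow> b \<in> B \<Longrightarrow> Q (r \<odot>\<^bsub>free_module R B\<^esub> basis_elt R b)"
    and add: "\<And>f g. f \<in> carrier (free_module R B) \<Longrightarrow> g \<in> carrier (free_module R B) \<Longrightarrow>
      Q f \<Longrightarrow> Q g \<Longrightarrow> Q (f \<oplus>\<^bsub>free_module R B\<^esub> g)"
  shows "Q f"
proof -
  interpret cring R by fact
  let ?F = "free_module R B"
  interpret F: module R ?F by (rule module_free_module) fact
  note [simp] = free_module_apply_closed[OF assms(1), where B = B]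
  \<comment> \<open>\<open>S\<close> only has to contain the support, so a point of \<open>S\<close>
    where \<open>f\<close> vanishes does no harm.\<close>
  have "Q f" if "finite S" "f \<in> carrier ?F" "{b. f b \<noteq> \<zero>\<^bsub>R\<^esub>} \<subseteq> S" for S f
    using that
  proof (induction S arbitrary: f rule: finite_induct)
    case empty
    then have "f = \<zero>\<^bsub>?F\<^esub>" by (auto simp: zero_free_module)
    then show ?case using zero by simp
  next
    case (insert s S)
    show ?case
    proof (cases "s \<in> B")
      case False
      with insert.prems have "{b. f b \<noteq> \<zero>\<^bsub>R\<^esub>} \<subseteq> S" by (auto simp: carrier_free_module)
      with insert show ?thesis by blast
    next
      case True
      define g where "g = f(s := \<zero>\<^bsub>R\<^esub>)"
      have g: "g \<in> carrier ?F"
        unfolding carrier_free_module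
      proof (intro conjI)
        show "finite {b. g b \<noteq> \<zero>\<^bsub>R\<^esub>}"
          by (rule finite_subset[of _ "{b. f b \<noteq> \<zero>\<^bsub>R\<^esub>}"])
            (use insert.prems in \<open>auto simp: g_def carrier_free_module split: if_splits\<close>)
      qed (use insert.prems in \<open>auto simp: g_def carrier_free_module\<close>)
      have "{b. g b \<noteq> \<zero>\<^bsub>R\<^esub>} \<subseteq> S" using insert.prems by (auto simp: g_def)
      then have "Q g" using g insert.IH by blast
      moreover have fs: "f s \<in> carrier R" using insert.prems by simp
      moreover have "f = f s \<odot>\<^bsub>?F\<^esub> basis_elt R s \<oplus>\<^bsub>?F\<^esub> g"
        using insert.prems(1) fs
        by (auto simp: fun_eq_iff add_free_module smult_free_module basis_elt_def g_def)
      ultimately show ?thesis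
        using add basis True g basis_elt_closed[OF assms(1) True] F.smult_closed by metis
    qed
  qed
  then show ?thesis using assms(2) by (auto simp: carrier_free_module)
qed

text \<open>\<open>linear_ext\<close> sums over the exact support, which changes under addition and
  scaling. Terms with coefficient zero contribute nothing, so a common finite index set may be used
  instead.\<close>

lemma linear_ext_superset:
  assumes "module R M" "\<And>b. b \<in> B \<Longrightarrow> \<phi> b \<in> carrier M" "f \<in> carrier (free_module R B)"
    and "finite S" "{b. f b \<noteq> \<zero>\<^bsub>R\<^esub>} \<subseteq> S" "S \<subseteq> B"
  shows "linear_ext R M \<phi> f = (\<Oplus>\<^bsub>M\<^esub>b \<in> S. f b \<odot>\<^bsub>M\<^esub> \<phi> b)"
proof -
  interpret M: module R M by fact
  show ?thesis
    unfolding linear_ext_def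
    by (rule M.add.finprod_mono_neutral_cong_left)
      (use assms in \<open>auto simp: free_module_apply_closed[OF M.R.is_cring assms(3)]\<close>)
qed

lemma linear_ext_linear:
  assumes "module R M" "\<And>b. b \<in> B \<Longrightarrow> \<phi> b \<in> carrier M"
  shows "linear_map R (free_module R B) M (linear_ext R M \<phi>)"
proof -
  interpret M: module R M by fact
  let ?F = "free_module R B"
  let ?s = "\<lambda>f. {b. f b \<noteq> \<zero>\<^bsub>R\<^esub>}"
  interpret F: module R ?F by (rule module_free_module) (rule M.R.is_cring)
  note [simp] = free_module_apply_closed[OF M.R.is_cring, where B = B]
  have s: "finite (?s f)" "?s f \<subseteq> B" if "f \<in> carrier ?F" for f
    using that by (auto simp: carrier_free_module)
  have ext: "linear_ext R M \<phi> f = (\<Oplus>\<^bsub>M\<^esub>b \<in> S. f b \<odot>\<^bsub>M\<^esub> \<phi> b)"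
    if "f \<in> carrier ?F" "finite S" "?s f \<subseteq> S" "S \<subseteq> B" for f S
    using assms that by (intro linear_ext_superset) auto
  have sub: "f b \<odot>\<^bsub>M\<^esub> \<phi> b \<in> carrier M" if "f \<in> carrier ?F" "b \<in> B" for f b
    using that assms(2) by simp
  show ?thesis
  proof (rule linear_mapI)
    fix f assume f: "f \<in> carrier ?F"
    show "linear_ext R M \<phi> f \<in> carrier M"
      unfolding linear_ext_def using f s[OF f] sub[OF f] by (intro M.finsum_closed) auto
  next
    fix f g assume f: "f \<in> carrier ?F" and g: "g \<in> carrier ?F"
    \<comment> \<open>Cancellation can make the support of the sum smaller than this union, but
      never larger.\<close>
    let ?S = "?s f \<union> ?s g"
    have S: "finite ?S" "?S \<subseteq> B" using s[OF f] s[OF g] by auto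
    have "linear_ext R M \<phi> (f \<oplus>\<^bsub>?F\<^esub> g) = (\<Oplus>\<^bsub>M\<^esub>b\<in>?S. (f \<oplus>\<^bsub>?F\<^esub> g) b \<odot>\<^bsub>M\<^esub> \<phi> b)"
      by (rule ext[OF F.a_closed[OF f g] S(1) _ S(2)]) (auto simp: add_free_module)
    also have "\<dots> = (\<Oplus>\<^bsub>M\<^esub>b\<in>?S. f b \<odot>\<^bsub>M\<^esub> \<phi> b \<oplus>\<^bsub>M\<^esub> g b \<odot>\<^bsub>M\<^esub> \<phi> b)"
      by (rule M.finsum_cong')
        (use f g S assms(2) in \<open>auto simp: add_free_module M.smult_l_distr subset_eq\<close>)
    also have "\<dots> = (\<Oplus>\<^bsub>M\<^esub>b\<in>?S. f b \<odot>\<^bsub>M\<^esub> \<phi> b) \<oplus>\<^bsub>M\<^esub> (\<Oplus>\<^bsub>M\<^esub>b\<in>?S. g b \<odot>\<^bsub>M\<^esub> \<phi> b)"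
      by (rule M.finsum_addf) (use f g S sub in \<open>auto simp: subset_eq\<close>)
    also have "\<dots> = linear_ext R M \<phi> f \<oplus>\<^bsub>M\<^esub> linear_ext R M \<phi> g"
      using ext[OF f S(1) _ S(2)] ext[OF g S(1) _ S(2)] by simp
    finally show "linear_ext R M \<phi> (f \<oplus>\<^bsub>?F\<^esub> g) = linear_ext R M \<phi> f \<oplus>\<^bsub>M\<^esub> linear_ext R M \<phi> g" .
  next
    fix r f assume r: "r \<in> carrier R" and f: "f \<in> carrier ?F"
    have "linear_ext R M \<phi> (r \<odot>\<^bsub>?F\<^esub> f) = (\<Oplus>\<^bsub>M\<^esub>b\<in>?s f. (r \<odot>\<^bsub>?F\<^esub> f) b \<odot>\<^bsub>M\<^esub> \<phi> b)"
      by (rule ext[OF F.smult_closed[OF r f] s(1)[OF f] _ s(2)[OF f]])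
        (use r in \<open>auto simp: smult_free_module\<close>)
    also have "\<dots> = (\<Oplus>\<^bsub>M\<^esub>b\<in>?s f. r \<odot>\<^bsub>M\<^esub> (f b \<odot>\<^bsub>M\<^esub> \<phi> b))"
      by (rule M.finsum_cong')
        (use r f s[OF f] assms(2) in \<open>auto simp: smult_free_module M.smult_assoc1 subset_eq\<close>)
    also have "\<dots> = r \<odot>\<^bsub>M\<^esub> linear_ext R M \<phi> f"
      unfolding linear_ext_def
      by (rule M.finsum_smult_ldistr[symmetric]) (use r f s[OF f] sub in \<open>auto simp: subset_eq\<close>)
    finally show "linear_ext R M \<phi> (r \<odot>\<^bsub>?F\<^esub> f) = r \<odot>\<^bsub>M\<^esub> linear_ext R M \<phi> f" .
  qed
qed

text \<open>The support of \<open>basis_elt R b\<close> is \<open>{b}\<close> except over the zero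
  ring, where it is empty; summing over the superset \<open>{b}\<close> treats both cases at
  once.\<close>

lemma linear_ext_basis:
  assumes "module R M" "\<phi> b \<in> carrier M"
  shows "linear_ext R M \<phi> (basis_elt R b) = \<phi> b"
proof -
  interpret M: module R M by fact
  have "linear_ext R M \<phi> (basis_elt R b) = (\<Oplus>\<^bsub>M\<^esub>c\<in>{b}. basis_elt R b c \<odot>\<^bsub>M\<^esub> \<phi> c)"
  proof (rule linear_ext_superset[where B = "{b}"])
    show "basis_elt R b \<in> carrier (free_module R {b})"
      by (rule basis_elt_closed[OF M.R.is_cring]) simp
  qed (use assms in \<open>auto simp: basis_elt_def\<close>)
  also have "\<dots> = \<phi> b" using assms(2) by (simp add: basis_elt_def)
  finally show ?thesis .
qed

text \<open>Linearity in \<open>f\<close> is that of the outer extension. For \<open>g\<close>,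
  which sits inside the summands, induction on \<open>f\<close> works because the maps linear in
  \<open>g\<close> are closed under sums and scaling. The product of \<open>H_leaf\<close> is an
  instance.\<close>

lemma linear_ext_bilinear:
  assumes "module R M" "\<And>u v. u \<in> B \<Longrightarrow> v \<in> C \<Longrightarrow> \<phi> u v \<in> carrier M"
  shows "bilinear_map R (free_module R B) (free_module R C) M
    (\<lambda>f g. linear_ext R M (\<lambda>u. linear_ext R M (\<phi> u) g) f)"
proof -
  interpret M: module R M by fact
  note R = M.R.is_cring
  note C = module_free_module[OF R, of C]
  have inner: "linear_map R (free_module R C) M (linear_ext R M (\<phi> u))" if "u \<in> B" for u
    using assms that by (intro linear_ext_linear) auto
  have outer: "linear_map R (free_module R B) M (linear_ext R M (\<lambda>u. linear_ext R M (\<phi> u) g))"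
    if "g \<in> carrier (free_module R C)" for g
    using assms(1) linear_map_closed[OF inner _] that by (intro linear_ext_linear) auto
  show ?thesis
  proof (rule bilinear_mapI[OF outer])
    fix f assume "f \<in> carrier (free_module R B)"
    with R show "linear_map R (free_module R C) M (\<lambda>g. linear_ext R M (\<lambda>u. linear_ext R M (\<phi> u) g) f)"
    proof (induction rule: free_module_induct)
      case zero
      show ?case
        using linear_map_zero[OF module_free_module[OF R] assms(1) outer]
        by (subst linear_map_cong[OF C, where g = "\<lambda>_. \<zero>\<^bsub>M\<^esub>"])
          (auto intro: linear_map_const_zero[OF assms(1)])
    next
      case (basis r b)
      show ?case
      proof (subst linear_map_cong[OF C])
        show "linear_map R (free_module R C) M (\<lambda>g. r \<odot>\<^bsub>M\<^esub> linear_ext R M (\<phi> b) g)"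
          using linear_map_scale[OF assms(1) inner] basis by auto
        fix g assume g: "g \<in> carrier (free_module R C)"
        show "linear_ext R M (\<lambda>u. linear_ext R M (\<phi> u) g) (r \<odot>\<^bsub>free_module R B\<^esub> basis_elt R b)
          = r \<odot>\<^bsub>M\<^esub> linear_ext R M (\<phi> b) g"
          using linear_map_smult[OF outer[OF g]] basis linear_map_closed[OF inner g]
          by (simp add: basis_elt_closed[OF R] linear_ext_basis[OF assms(1)])
      qed
    next
      case (add f f')
      then show ?case
        by (subst linear_map_cong[OF C, OF linear_map_add[OF outer]])
          (auto intro: linear_map_plus[OF assms(1)])
    qed
  qed
qed

section \<open>Quotient modules and tensor products\<close>

text \<open>As \<open>S\<close> lies in the carrier, the carrier is one of the intersected
  submodules, which keeps the intersection inside \<open>M\<close>.\<close>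

lemma submodule_generated_submodule:
  assumes "module R M" "S \<subseteq> carrier M"
  shows "submodule (submodule_generated R M S) R M"
proof -
  interpret M: module R M by fact
  have sub: "submodule_generated R M S \<subseteq> carrier M"
    using M.carrier_is_submodule assms(2) by (auto simp: submodule_generated_def)
  have "\<zero>\<^bsub>M\<^esub> \<in> N" if "submodule N R M" for N
    using subgroup.one_closed[OF submodule.axioms(1)[OF that]] by simp
  then show ?thesis
    using M.submoduleE(3-5) by (intro M.submoduleI[OF sub]) (auto simp: submodule_generated_def)
qed

lemma submodule_generated_incl: "S \<subseteq> submodule_generated R M S"
  by (auto simp: submodule_generated_def)

lemma submodule_generated_minimal:
  "submodule N R M \<Longrightarrow> S \<subseteq> N \<Longrightarrow> submodule_generated R M S \<subseteq> N"
  by (auto simp: submodule_generated_def)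

lemma submodule_abelian_subgroup:
  assumes "module R M" "submodule N R M"
  shows "abelian_subgroup N M"
proof -
  interpret M: module R M by fact
  show ?thesis
    by (rule abelian_subgroupI3) (auto intro!: additive_subgroup.intro submodule.axioms(1)[OF assms(2)]
      M.abelian_group_axioms)
qed

lemma carrier_quotient_module:
  "carrier (quotient_module M N) = (\<lambda>x. N +>\<^bsub>M\<^esub> x) ` carrier M"
  by (auto simp: quotient_module_def A_RCOSETS_def RCOSETS_def a_r_coset_def)

lemma quotient_module_laws:
  assumes "module R M" "submodule N R M"
  shows add_quotient_module: "\<lbrakk>x \<in> carrier M; y \<in> carrier M\<rbrakk> \<Longrightarrow>
      (N +>\<^bsub>M\<^esub> x) \<oplus>\<^bsub>quotient_module M N\<^esub> (N +>\<^bsub>M\<^esub> y) = N +>\<^bsub>M\<^esub> (x \<oplus>\<^bsub>M\<^esub> y)"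
    and smult_quotient_module: "\<lbrakk>r \<in> carrier R; x \<in> carrier M\<rbrakk> \<Longrightarrow>
      r \<odot>\<^bsub>quotient_module M N\<^esub> (N +>\<^bsub>M\<^esub> x) = N +>\<^bsub>M\<^esub> (r \<odot>\<^bsub>M\<^esub> x)"
    and zero_quotient_module: "\<zero>\<^bsub>quotient_module M N\<^esub> = N +>\<^bsub>M\<^esub> \<zero>\<^bsub>M\<^esub>"
    and coset_eqI: "\<lbrakk>x \<in> carrier M; y \<in> carrier M; x \<ominus>\<^bsub>M\<^esub> y \<in> N\<rbrakk> \<Longrightarrow> N +>\<^bsub>M\<^esub> x = N +>\<^bsub>M\<^esub> y"
    and coset_memD: "\<lbrakk>x \<in> carrier M; y \<in> N +>\<^bsub>M\<^esub> x\<rbrakk> \<Longrightarrow> y \<in> carrier M \<and> y \<ominus>\<^bsub>M\<^esub> x \<in> N"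
proof -
  interpret M: module R M by fact
  interpret N: abelian_subgroup N M by (rule submodule_abelian_subgroup) fact+
  show "(N +>\<^bsub>M\<^esub> x) \<oplus>\<^bsub>quotient_module M N\<^esub> (N +>\<^bsub>M\<^esub> y) = N +>\<^bsub>M\<^esub> (x \<oplus>\<^bsub>M\<^esub> y)"
    if "x \<in> carrier M" "y \<in> carrier M"
    using that by (simp add: quotient_module_def N.a_rcos_sum)
  show "\<zero>\<^bsub>quotient_module M N\<^esub> = N +>\<^bsub>M\<^esub> \<zero>\<^bsub>M\<^esub>"
    by (simp add: quotient_module_def N.a_rcos_const)
  show eq: "N +>\<^bsub>M\<^esub> x = N +>\<^bsub>M\<^esub> y" if "x \<in> carrier M" "y \<in> carrier M" "x \<ominus>\<^bsub>M\<^esub> y \<in> N" for x y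
    using that N.a_rcos_module_rev[of y x] N.a_repr_independence'[of x y] by (simp add: a_minus_def)
  show mem: "y \<in> carrier M \<and> y \<ominus>\<^bsub>M\<^esub> x \<in> N" if "x \<in> carrier M" "y \<in> N +>\<^bsub>M\<^esub> x" for x y
    using that N.a_rcos_module_imp[of x y] N.a_elemrcos_carrier[of x y] by (simp add: a_minus_def)
  show "r \<odot>\<^bsub>quotient_module M N\<^esub> (N +>\<^bsub>M\<^esub> x) = N +>\<^bsub>M\<^esub> (r \<odot>\<^bsub>M\<^esub> x)"
    if r: "r \<in> carrier R" and x: "x \<in> carrier M"
  proof -
    \<comment> \<open>Scalar multiplication on the quotient is a union over all representatives. All
      members of the union are the same coset, and the union is not over an empty set since
      \<open>x\<close> lies in its own coset.\<close>
    have rep: "N +>\<^bsub>M\<^esub> (r \<odot>\<^bsub>M\<^esub> y) = N +>\<^bsub>M\<^esub> (r \<odot>\<^bsub>M\<^esub> x)" if y: "y \<in> N +>\<^bsub>M\<^esub> x" for y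
    proof (rule eq)
      have "r \<odot>\<^bsub>M\<^esub> (y \<ominus>\<^bsub>M\<^esub> x) \<in> N"
        using mem[OF x y] M.submoduleE(4)[OF assms(2)] r by blast
      then show "r \<odot>\<^bsub>M\<^esub> y \<ominus>\<^bsub>M\<^esub> r \<odot>\<^bsub>M\<^esub> x \<in> N"
        using mem[OF x y] r x by (simp add: a_minus_def M.smult_r_distr M.smult_r_minus)
    qed (use mem[OF x y] r x in auto)
    have "r \<odot>\<^bsub>quotient_module M N\<^esub> (N +>\<^bsub>M\<^esub> x) = (\<Union>y\<in>N +>\<^bsub>M\<^esub> x. N +>\<^bsub>M\<^esub> (r \<odot>\<^bsub>M\<^esub> y))"
      by (simp add: quotient_module_def)
    also have "\<dots> = (\<Union>y\<in>N +>\<^bsub>M\<^esub> x. N +>\<^bsub>M\<^esub> (r \<odot>\<^bsub>M\<^esub> x))"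
      by (rule SUP_cong[OF refl rep])
    also have "\<dots> = N +>\<^bsub>M\<^esub> (r \<odot>\<^bsub>M\<^esub> x)"
      using N.a_rcos_self[OF x] by blast
    finally show ?thesis .
  qed
qed

lemma module_quotient_module:
  assumes "module R M" "submodule N R M"
  shows "module R (quotient_module M N)"
proof -
  interpret M: module R M by fact
  note [simp] = add_quotient_module[OF assms] smult_quotient_module[OF assms]
    zero_quotient_module[OF assms] carrier_quotient_module
  show ?thesis
  proof (rule moduleI[OF M.R.is_cring])
    show "abelian_group (quotient_module M N)"
    proof (rule abelian_groupI)
      fix C assume "C \<in> carrier (quotient_module M N)"
      then obtain x where x: "x \<in> carrier M" "C = N +>\<^bsub>M\<^esub> x" by auto
      then show "\<exists>D\<in>carrier (quotient_module M N).
          D \<oplus>\<^bsub>quotient_module M N\<^esub> C = \<zero>\<^bsub>quotient_module M N\<^esub>"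
        by (intro bexI[of _ "N +>\<^bsub>M\<^esub> (\<ominus>\<^bsub>M\<^esub> x)"]) (auto simp: M.l_neg)
    qed (auto simp: M.a_ac)
  qed (auto simp: M.smult_l_distr M.smult_r_distr M.smult_assoc1)
qed

section \<open>Tensor products: module structure, pure tensors, induction\<close>

lemma module_tensor_free: "module R M \<Longrightarrow> module R (tensor_free R M N)"
  by (simp add: tensor_free_def module_free_module module.axioms(1))

lemma tensor_free_basis_closed:
  "\<lbrakk>module R M; m \<in> carrier M; n \<in> carrier N\<rbrakk> \<Longrightarrow> basis_elt R (m, n) \<in> carrier (tensor_free R M N)"
  by (simp add: tensor_free_def basis_elt_closed module.axioms(1))

lemma tensor_null_submodule:
  assumes "module R M" "module R N"
  shows "submodule (tensor_null R M N) R (tensor_free R M N)"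
proof -
  interpret M: module R M by fact
  interpret N: module R N by fact
  interpret F: module R "tensor_free R M N" by (rule module_tensor_free) fact
  note [simp] = tensor_free_basis_closed[OF assms(1)]
  have "tensor_relators R M N \<subseteq> carrier (tensor_free R M N)"
    by (auto simp: tensor_relators_def Let_def)
  then show ?thesis
    unfolding tensor_null_def by (rule submodule_generated_submodule[OF F.module_axioms])
qed

lemma module_tensor:
  assumes "module R M" "module R N"
  shows "module R (tensor R M N)"
  unfolding tensor_def
  by (rule module_quotient_module[OF module_tensor_free tensor_null_submodule]) fact+

text \<open>Each of the four laws says that two cosets agree, and their representatives differ by a
  relator of the corresponding family.\<close>

lemma pure_tensor_bilinear:
  assumes "module R M" "module R N"
  shows "bilinear_map R M N (tensor R M N) (pure_tensor R M N)"
proof -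
  interpret M: module R M by fact
  interpret N: module R N by fact
  interpret F: module R "tensor_free R M N" by (rule module_tensor_free) fact
  note [simp] = tensor_free_basis_closed[OF assms(1)]
  note sub = F.module_axioms tensor_null_submodule[OF assms]
  note [simp] = add_quotient_module[OF sub] smult_quotient_module[OF sub]
  have rel: "z \<in> tensor_relators R M N \<Longrightarrow> z \<in> tensor_null R M N" for z
    using submodule_generated_incl unfolding tensor_null_def by fast
  have cl: "pure_tensor R M N m n \<in> carrier (tensor R M N)" if "m \<in> carrier M" "n \<in> carrier N" for m n
    using that by (simp add: pure_tensor_def tensor_def carrier_quotient_module)
  show ?thesis
  proof (intro bilinear_mapI linear_mapI cl)
    fix n m m' assume "n \<in> carrier N" "m \<in> carrier M" "m' \<in> carrier M"
    then show "pure_tensor R M N (m \<oplus>\<^bsub>M\<^esub> m') n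
      = pure_tensor R M N m n \<oplus>\<^bsub>tensor R M N\<^esub> pure_tensor R M N m' n"
      unfolding pure_tensor_def tensor_def
      by simp (intro coset_eqI[OF sub] rel, simp, simp, auto simp: tensor_relators_def Let_def)
  next
    fix n r m assume "n \<in> carrier N" "m \<in> carrier M" "r \<in> carrier R"
    then show "pure_tensor R M N (r \<odot>\<^bsub>M\<^esub> m) n = r \<odot>\<^bsub>tensor R M N\<^esub> pure_tensor R M N m n"
      unfolding pure_tensor_def tensor_def
      by simp (intro coset_eqI[OF sub] rel, simp, simp, auto simp: tensor_relators_def Let_def)
  next
    fix m n n' assume "m \<in> carrier M" "n \<in> carrier N" "n' \<in> carrier N"
    then show "pure_tensor R M N m (n \<oplus>\<^bsub>N\<^esub> n')
      = pure_tensor R M N m n \<oplus>\<^bsub>tensor R M N\<^esub> pure_tensor R M N m n'"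
      unfolding pure_tensor_def tensor_def
      by simp (intro coset_eqI[OF sub] rel, simp, simp, auto simp: tensor_relators_def Let_def)
  next
    fix m r n assume "m \<in> carrier M" "n \<in> carrier N" "r \<in> carrier R"
    then show "pure_tensor R M N m (r \<odot>\<^bsub>N\<^esub> n) = r \<odot>\<^bsub>tensor R M N\<^esub> pure_tensor R M N m n"
      unfolding pure_tensor_def tensor_def
      by simp (intro coset_eqI[OF sub] rel, simp, simp, auto simp: tensor_relators_def Let_def)
  qed
qed

lemma pure_tensor_closed:
  "\<lbrakk>module R M; module R N; m \<in> carrier M; n \<in> carrier N\<rbrakk>
    \<Longrightarrow> pure_tensor R M N m n \<in> carrier (tensor R M N)"
  by (rule bilinear_map_closed[OF pure_tensor_bilinear])

text \<open>Neither a zero nor a scalar case arises: a scalar is absorbed into the left factor,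
  \<open>r (m \<otimes> n) = (r m) \<otimes> n\<close>, and the zero tensor is the pure tensor
  \<open>0 \<otimes> 0\<close>.\<close>

lemma tensor_induct [consumes 3, case_names pure add]:
  assumes "module R M" "module R N" "t \<in> carrier (tensor R M N)"
    and pure: "\<And>m n. m \<in> carrier M \<Longrightarrow> n \<in> carrier N \<Longrightarrow> Q (pure_tensor R M N m n)"
    and add: "\<And>s t. s \<in> carrier (tensor R M N) \<Longrightarrow> t \<in> carrier (tensor R M N) \<Longrightarrow>
      Q s \<Longrightarrow> Q t \<Longrightarrow> Q (s \<oplus>\<^bsub>tensor R M N\<^esub> t)"
  shows "Q t"
proof -
  interpret M: module R M by fact
  interpret N: module R N by fact
  interpret T: module R "tensor R M N" by (rule module_tensor) fact+
  let ?N = "tensor_null R M N" and ?F = "tensor_free R M N"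
  note bil = pure_tensor_bilinear[OF assms(1,2)]
  note sub = module_tensor_free[OF assms(1)] tensor_null_submodule[OF assms(1,2)]
  obtain f where f: "f \<in> carrier ?F" and t: "t = ?N +>\<^bsub>?F\<^esub> f"
    using assms(3) by (auto simp: tensor_def carrier_quotient_module)
  have "f \<in> carrier (free_module R (carrier M \<times> carrier N))" using f by (simp add: tensor_free_def)
  \<comment> \<open>Membership in the carrier is carried along because the hypothesis
    \<open>add\<close> asks for it.\<close>
  with M.R.is_cring have "?N +>\<^bsub>?F\<^esub> f \<in> carrier (tensor R M N) \<and> Q (?N +>\<^bsub>?F\<^esub> f)"
  proof (induction rule: free_module_induct)
    case zero
    have "\<zero>\<^bsub>R\<^esub> \<odot>\<^bsub>tensor R M N\<^esub> pure_tensor R M N \<zero>\<^bsub>M\<^esub> \<zero>\<^bsub>N\<^esub>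
        = pure_tensor R M N (\<zero>\<^bsub>R\<^esub> \<odot>\<^bsub>M\<^esub> \<zero>\<^bsub>M\<^esub>) \<zero>\<^bsub>N\<^esub>"
      by (rule linear_map_smult[OF bilinear_map_left[OF bil], symmetric]) auto
    then have "\<zero>\<^bsub>tensor R M N\<^esub> = pure_tensor R M N \<zero>\<^bsub>M\<^esub> \<zero>\<^bsub>N\<^esub>"
      using bilinear_map_closed[OF bil, of "\<zero>\<^bsub>M\<^esub>" "\<zero>\<^bsub>N\<^esub>"] by simp
    then have "Q \<zero>\<^bsub>tensor R M N\<^esub>" using pure by auto
    moreover have "\<zero>\<^bsub>tensor R M N\<^esub> = ?N +>\<^bsub>?F\<^esub> \<zero>\<^bsub>?F\<^esub>"
      unfolding tensor_def by (rule zero_quotient_module[OF sub])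
    ultimately show ?case using T.zero_closed by (simp add: tensor_free_def)
  next
    case (basis r b)
    then obtain m n where b: "b = (m, n)" "m \<in> carrier M" "n \<in> carrier N" by auto
    have "?N +>\<^bsub>?F\<^esub> (r \<odot>\<^bsub>?F\<^esub> basis_elt R b) = r \<odot>\<^bsub>tensor R M N\<^esub> pure_tensor R M N m n"
      using smult_quotient_module[OF sub, of r "basis_elt R b"] basis b
      by (simp add: tensor_free_basis_closed[OF assms(1)] tensor_def pure_tensor_def)
    also have "\<dots> = pure_tensor R M N (r \<odot>\<^bsub>M\<^esub> m) n"
      using linear_map_smult[OF bilinear_map_left[OF bil]] basis b by simp
    finally show ?case
      using pure[of "r \<odot>\<^bsub>M\<^esub> m" n] bilinear_map_closed[OF bil, of "r \<odot>\<^bsub>M\<^esub> m" n] basis b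
      by (simp add: tensor_free_def)
  next
    case (add f g)
    then have "(?N +>\<^bsub>?F\<^esub> f) \<oplus>\<^bsub>tensor R M N\<^esub> (?N +>\<^bsub>?F\<^esub> g) = ?N +>\<^bsub>?F\<^esub> (f \<oplus>\<^bsub>?F\<^esub> g)"
      using add_quotient_module[OF sub, of f g] by (simp add: tensor_def tensor_free_def)
    with add show ?case
      using assms(5)[of "?N +>\<^bsub>?F\<^esub> f" "?N +>\<^bsub>?F\<^esub> g"]
        T.a_closed[of "?N +>\<^bsub>?F\<^esub> f" "?N +>\<^bsub>?F\<^esub> g"] by (simp add: tensor_free_def)
  qed
  then show ?thesis using t by simp
qed

section \<open>The universal property of the tensor product\<close>

context
  fixes R :: "('r, 'z) ring_scheme" and M :: "('r, 'a, 'm) module_scheme"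
    and N :: "('r, 'b, 'n) module_scheme" and P :: "('r, 'p, 'q) module_scheme" and \<beta>
  assumes M: "module R M" and N: "module R N" and P: "module R P"
    and \<beta>: "bilinear_map R M N P \<beta>"
begin

lemma linear_ext_tensor_free: "linear_map R (tensor_free R M N) P (linear_ext R P (\<lambda>(m, n). \<beta> m n))"
  unfolding tensor_free_def
  by (rule linear_ext_linear[OF P]) (auto intro: bilinear_map_closed[OF \<beta>])

text \<open>By bilinearity of \<open>\<beta>\<close> the kernel of the extension contains all
  relators; being a submodule, it contains the submodule that they generate.\<close>

lemma linear_ext_tensor_null:
  assumes "z \<in> tensor_null R M N"
  shows "linear_ext R P (\<lambda>(m, n). \<beta> m n) z = \<zero>\<^bsub>P\<^esub>"
proof -
  interpret M: module R M by (rule M)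
  interpret N: module R N by (rule N)
  interpret P: module R P by (rule P)
  interpret F: module R "tensor_free R M N" by (rule module_tensor_free[OF M])
  let ?L = "linear_ext R P (\<lambda>(m, n). \<beta> m n)" and ?F = "tensor_free R M N"
  note lin = linear_ext_tensor_free
  note L = linear_map_add[OF lin] linear_map_smult[OF lin] linear_map_closed[OF lin]
    linear_map_zero[OF F.module_axioms P lin] linear_map_a_inv[OF F.module_axioms P lin]
    linear_map_minus[OF F.module_axioms P lin]
  note [simp] = tensor_free_basis_closed[OF M] bilinear_map_closed[OF \<beta>]
  have e: "?L (basis_elt R (m, n)) = \<beta> m n" if "m \<in> carrier M" "n \<in> carrier N" for m n
    using that by (subst linear_ext_basis[OF P]) auto
  note b = linear_map_add[OF bilinear_map_left[OF \<beta>]] linear_map_smult[OF bilinear_map_left[OF \<beta>]]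
    linear_map_add[OF bilinear_map_right[OF \<beta>]] linear_map_smult[OF bilinear_map_right[OF \<beta>]]
  have "submodule {z \<in> carrier ?F. ?L z = \<zero>\<^bsub>P\<^esub>} R ?F"
    by (rule F.submoduleI) (auto simp: L)
  moreover have "tensor_relators R M N \<subseteq> {z \<in> carrier ?F. ?L z = \<zero>\<^bsub>P\<^esub>}"
    by (auto simp: tensor_relators_def Let_def L e b P.r_neg a_minus_def)
  ultimately have "tensor_null R M N \<subseteq> {z \<in> carrier ?F. ?L z = \<zero>\<^bsub>P\<^esub>}"
    unfolding tensor_null_def by (rule submodule_generated_minimal)
  then show ?thesis using assms by auto
qed

text \<open>The representative chosen by \<open>SOME\<close> differs from \<open>f\<close> by an
  element of \<open>tensor_null\<close>, which the extension kills. From here on the choice is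
  invisible.\<close>

lemma tensor_lift_coset:
  assumes f: "f \<in> carrier (tensor_free R M N)"
  shows "tensor_lift R P \<beta> (tensor_null R M N +>\<^bsub>tensor_free R M N\<^esub> f)
    = linear_ext R P (\<lambda>(m, n). \<beta> m n) f"
proof -
  interpret P: module R P by (rule P)
  interpret F: module R "tensor_free R M N" by (rule module_tensor_free[OF M])
  let ?L = "linear_ext R P (\<lambda>(m, n). \<beta> m n)" and ?F = "tensor_free R M N" and ?N = "tensor_null R M N"
  note sub = F.module_axioms tensor_null_submodule[OF M N]
  interpret S: abelian_subgroup ?N ?F by (rule submodule_abelian_subgroup[OF sub])
  define g where "g = (SOME g. g \<in> ?N +>\<^bsub>?F\<^esub> f)"
  have "g \<in> ?N +>\<^bsub>?F\<^esub> f" unfolding g_def by (rule someI[of _ f]) (rule S.a_rcos_self[OF f])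
  then have g: "g \<in> carrier ?F" "g \<ominus>\<^bsub>?F\<^esub> f \<in> ?N" using coset_memD[OF sub f] by auto
  have "?L g \<ominus>\<^bsub>P\<^esub> ?L f = \<zero>\<^bsub>P\<^esub>"
    using linear_ext_tensor_null[OF g(2)]
      linear_map_minus[OF F.module_axioms P linear_ext_tensor_free g(1) f] by simp
  then have "?L g = ?L f"
    using linear_map_closed[OF linear_ext_tensor_free] g(1) f
      P.minus_equality[of "?L g" "\<ominus>\<^bsub>P\<^esub> ?L f"] by (simp add: a_minus_def)
  then show ?thesis by (simp add: tensor_lift_def g_def)
qed

lemma tensor_lift_linear: "linear_map R (tensor R M N) P (tensor_lift R P \<beta>)"
proof -
  interpret F: module R "tensor_free R M N" by (rule module_tensor_free[OF M])
  note sub = F.module_axioms tensor_null_submodule[OF M N]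
  note [simp] = add_quotient_module[OF sub] smult_quotient_module[OF sub] carrier_quotient_module
    tensor_lift_coset
  show ?thesis
    unfolding tensor_def
    by (rule linear_mapI)
      (auto simp: linear_map_add[OF linear_ext_tensor_free] linear_map_smult[OF linear_ext_tensor_free]
        linear_map_closed[OF linear_ext_tensor_free])
qed

lemma tensor_lift_pure:
  assumes "m \<in> carrier M" "n \<in> carrier N"
  shows "tensor_lift R P \<beta> (pure_tensor R M N m n) = \<beta> m n"
  using assms
  by (simp add: pure_tensor_def tensor_lift_coset tensor_free_basis_closed[OF M]
      linear_ext_basis[OF P] bilinear_map_closed[OF \<beta>])

end

section \<open>Functoriality of the tensor product\<close>

context
  fixes R :: "('r, 'z) ring_scheme" and M :: "('r, 'a, 'm) module_scheme"
    and N :: "('r, 'b, 'n) module_scheme" and P :: "('r, 'p, 'q) module_scheme"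
    and Q :: "('r, 's, 't) module_scheme" and f g
  assumes modules: "module R M" "module R N" "module R P" "module R Q"
    and linear: "linear_map R M P f" "linear_map R N Q g"
begin

lemma tensor_map_bilinear: "bilinear_map R M N (tensor R P Q) (\<lambda>m n. pure_tensor R P Q (f m) (g n))"
  using bilinear_map_comp[OF pure_tensor_bilinear[OF modules(3,4)] linear] .

lemma tensor_map_linear: "linear_map R (tensor R M N) (tensor R P Q) (tensor_map R P Q f g)"
  unfolding tensor_map_def
  using tensor_lift_linear[OF modules(1,2) module_tensor[OF modules(3,4)] tensor_map_bilinear] .

lemma tensor_map_pure:
  "m \<in> carrier M \<Longrightarrow> n \<in> carrier N \<Longrightarrow>
    tensor_map R P Q f g (pure_tensor R M N m n) = pure_tensor R P Q (f m) (g n)"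
  unfolding tensor_map_def
  using tensor_lift_pure[OF modules(1,2) module_tensor[OF modules(3,4)] tensor_map_bilinear] .

end

text \<open>The parameter \<open>z\<close> belongs to the lifted map and not to the tensor, so the
  universal property says nothing about it; induction on \<open>t\<close> reduces the claim to pure
  tensors. This provides the third argument of the associator.\<close>

lemma tensor_lift_param_linear:
  assumes M: "module R M" and N: "module R N" and P: "module R P" and Z: "module R Z"
    and \<beta>: "\<And>z. z \<in> carrier Z \<Longrightarrow> bilinear_map R M N P (\<beta> z)"
    and lin: "\<And>m n. m \<in> carrier M \<Longrightarrow> n \<in> carrier N \<Longrightarrow> linear_map R Z P (\<lambda>z. \<beta> z m n)"
    and t: "t \<in> carrier (tensor R M N)"
  shows "linear_map R Z P (\<lambda>z. tensor_lift R P (\<beta> z) t)"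
  using M N t
proof (induction rule: tensor_induct)
  case (pure m n)
  then show ?case
    using lin by (subst linear_map_cong[OF Z, OF tensor_lift_pure[OF M N P \<beta>]]) auto
next
  case (add s t)
  then show ?case
    by (subst linear_map_cong[OF Z, OF linear_map_add[OF tensor_lift_linear[OF M N P \<beta>]]])
      (auto intro: linear_map_plus[OF P])
qed

section \<open>The associator\<close>

context
  fixes R :: "('r, 'z) ring_scheme" and L :: "('r, 'a, 'l) module_scheme"
    and M :: "('r, 'b, 'm) module_scheme" and N :: "('r, 'c, 'n) module_scheme"
  assumes modules: "module R L" "module R M" "module R N"
begin

private abbreviation (input) "triple x y z \<equiv> pure_tensor R L (tensor R M N) x (pure_tensor R M N y z)"

private lemma triple_bilinear:
  assumes "z \<in> carrier N"
  shows "bilinear_map R L M (tensor R L (tensor R M N)) (\<lambda>x y. triple x y z)"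
  by (rule bilinear_map_comp[OF pure_tensor_bilinear linear_map_id
      bilinear_map_left[OF pure_tensor_bilinear]])
    (simp_all add: modules assms module_tensor)

private lemma triple_linear:
  assumes "x \<in> carrier L" "y \<in> carrier M"
  shows "linear_map R N (tensor R L (tensor R M N)) (\<lambda>z. triple x y z)"
  by (rule linear_map_comp[OF bilinear_map_right[OF pure_tensor_bilinear]
      bilinear_map_right[OF pure_tensor_bilinear]])
    (simp_all add: modules assms module_tensor)

private lemma assoc_bilinear:
  "bilinear_map R (tensor R L M) N (tensor R L (tensor R M N))
    (\<lambda>t z. tensor_lift R (tensor R L (tensor R M N)) (\<lambda>x y. triple x y z) t)"
proof (rule bilinear_mapI)
  fix z assume "z \<in> carrier N"
  then show "linear_map R (tensor R L M) (tensor R L (tensor R M N))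
      (\<lambda>t. tensor_lift R (tensor R L (tensor R M N)) (\<lambda>x y. triple x y z) t)"
    by (intro tensor_lift_linear triple_bilinear) (simp_all add: modules module_tensor)
next
  fix t assume "t \<in> carrier (tensor R L M)"
  then show "linear_map R N (tensor R L (tensor R M N))
      (\<lambda>z. tensor_lift R (tensor R L (tensor R M N)) (\<lambda>x y. triple x y z) t)"
    by (intro tensor_lift_param_linear[OF modules(1,2) _ modules(3)] triple_bilinear triple_linear)
      (simp_all add: modules module_tensor)
qed

lemma tensor_assoc_linear:
  "linear_map R (tensor R (tensor R L M) N) (tensor R L (tensor R M N)) (tensor_assoc R L M N)"
  unfolding tensor_assoc_def Let_def
  by (intro tensor_lift_linear assoc_bilinear) (simp_all add: modules module_tensor)

lemma tensor_assoc_pure: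
  assumes "x \<in> carrier L" "y \<in> carrier M" "z \<in> carrier N"
  shows "tensor_assoc R L M N (pure_tensor R (tensor R L M) N (pure_tensor R L M x y) z)
    = pure_tensor R L (tensor R M N) x (pure_tensor R M N y z)"
  unfolding tensor_assoc_def Let_def using assms
  by (simp add: modules module_tensor pure_tensor_closed triple_bilinear
      tensor_lift_pure[OF _ _ _ assoc_bilinear] tensor_lift_pure[OF _ _ _ triple_bilinear])

end

section \<open>Algebras with a derivation into the tensor square\<close>

context unitary_algebra
begin

lemma mult_left_linear: "a \<in> carrier A \<Longrightarrow> linear_map R A A (\<lambda>b. a \<otimes>\<^bsub>A\<^esub> b)"
  by (rule linear_mapI) (simp_all add: r_distr smult_mult_right)

lemma mult_right_linear: "a \<in> carrier A \<Longrightarrow> linear_map R A A (\<lambda>b. b \<otimes>\<^bsub>A\<^esub> a)"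
  by (rule linear_mapI) (simp_all add: l_distr smult_mult_left)

lemmas module_square = module_tensor[OF module_axioms module_axioms]
lemmas pure_bilinear = pure_tensor_bilinear[OF module_axioms module_axioms]

lemma left_action_linear: "a \<in> carrier A \<Longrightarrow> linear_map R (tensor R A A) (tensor R A A) (left_action R A a)"
  unfolding left_action_def
  by (rule tensor_map_linear[OF module_axioms module_axioms module_axioms module_axioms
      mult_left_linear linear_map_id])

lemma left_action_pure:
  "\<lbrakk>a \<in> carrier A; x \<in> carrier A; y \<in> carrier A\<rbrakk>
    \<Longrightarrow> left_action R A a (pure_tensor R A A x y) = pure_tensor R A A (a \<otimes>\<^bsub>A\<^esub> x) y"
  unfolding left_action_def
  by (rule tensor_map_pure[OF module_axioms module_axioms module_axioms module_axioms
      mult_left_linear linear_map_id])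

lemma right_action_linear:
  "a \<in> carrier A \<Longrightarrow> linear_map R (tensor R A A) (tensor R A A) (\<lambda>t. right_action R A t a)"
  unfolding right_action_def
  by (rule tensor_map_linear[OF module_axioms module_axioms module_axioms module_axioms
      linear_map_id mult_right_linear])

lemma right_action_pure:
  "\<lbrakk>a \<in> carrier A; x \<in> carrier A; y \<in> carrier A\<rbrakk>
    \<Longrightarrow> right_action R A (pure_tensor R A A x y) a = pure_tensor R A A x (y \<otimes>\<^bsub>A\<^esub> a)"
  unfolding right_action_def
  by (rule tensor_map_pure[OF module_axioms module_axioms module_axioms module_axioms
      linear_map_id mult_right_linear])

text \<open>Linearity in the tensor is built in; linearity in \<open>a\<close> needs an induction on
  the tensor. The latter is what makes \<open>v \<mapsto> v \<cdot> t\<close> an admissible second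
  factor in the definition of \<open>join\<close>.\<close>

lemma left_action_bilinear: "bilinear_map R A (tensor R A A) (tensor R A A) (left_action R A)"
proof (rule bilinear_mapI[OF _ left_action_linear])
  fix t assume "t \<in> carrier (tensor R A A)"
  with module_axioms module_axioms show "linear_map R A (tensor R A A) (\<lambda>a. left_action R A a t)"
  proof (induction rule: tensor_induct)
    case (pure x y)
    then show ?case
      by (subst linear_map_cong[OF module_axioms left_action_pure])
        (auto intro: linear_map_comp[OF mult_right_linear bilinear_map_left[OF pure_bilinear]])
  next
    case (add s t)
    then show ?case
      by (subst linear_map_cong[OF module_axioms linear_map_add[OF left_action_linear]])
        (auto intro: linear_map_plus[OF module_square])
  qed
qed

lemma right_action_bilinear: "bilinear_map R (tensor R A A) A (tensor R A A) (right_action R A)"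
proof (rule bilinear_mapI[OF right_action_linear])
  fix t assume "t \<in> carrier (tensor R A A)"
  with module_axioms module_axioms show "linear_map R A (tensor R A A) (right_action R A t)"
  proof (induction rule: tensor_induct)
    case (pure x y)
    then show ?case
      by (subst linear_map_cong[OF module_axioms right_action_pure])
        (auto intro: linear_map_comp[OF mult_left_linear bilinear_map_right[OF pure_bilinear]])
  next
    case (add s t)
    then show ?case
      by (subst linear_map_cong[OF module_axioms linear_map_add[OF right_action_linear]])
        (auto intro: linear_map_plus[OF module_square])
  qed
qed

lemma left_action_closed:
  "\<lbrakk>a \<in> carrier A; t \<in> carrier (tensor R A A)\<rbrakk> \<Longrightarrow> left_action R A a t \<in> carrier (tensor R A A)"
  by (rule linear_map_closed[OF left_action_linear])

lemma right_action_closed: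
  "\<lbrakk>a \<in> carrier A; t \<in> carrier (tensor R A A)\<rbrakk> \<Longrightarrow> right_action R A t a \<in> carrier (tensor R A A)"
  by (rule linear_map_closed[OF right_action_linear])

text \<open>The tensor square is a unital bimodule. These laws drive the extension of the derivation
  rule from single trees to concatenated forests.\<close>

lemma action_laws:
  assumes "t \<in> carrier (tensor R A A)"
  shows left_action_one: "left_action R A \<one>\<^bsub>A\<^esub> t = t"
    and right_action_one: "right_action R A t \<one>\<^bsub>A\<^esub> = t"
    and left_action_mult: "\<lbrakk>a \<in> carrier A; b \<in> carrier A\<rbrakk> \<Longrightarrow>
      left_action R A a (left_action R A b t) = left_action R A (a \<otimes>\<^bsub>A\<^esub> b) t"
    and right_action_mult: "\<lbrakk>a \<in> carrier A; b \<in> carrier A\<rbrakk> \<Longrightarrow>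
      right_action R A (right_action R A t a) b = right_action R A t (a \<otimes>\<^bsub>A\<^esub> b)"
    and left_right_action: "\<lbrakk>a \<in> carrier A; b \<in> carrier A\<rbrakk> \<Longrightarrow>
      left_action R A a (right_action R A t b) = right_action R A (left_action R A a t) b"
proof -
  note [simp] = linear_map_add[OF left_action_linear] linear_map_add[OF right_action_linear]
    left_action_closed right_action_closed left_action_pure right_action_pure m_assoc
  show "left_action R A \<one>\<^bsub>A\<^esub> t = t"
    using module_axioms module_axioms assms by (induction rule: tensor_induct) simp_all
  show "right_action R A t \<one>\<^bsub>A\<^esub> = t"
    using module_axioms module_axioms assms by (induction rule: tensor_induct) simp_all
  assume a: "a \<in> carrier A" and b: "b \<in> carrier A"
  show "left_action R A a (left_action R A b t) = left_action R A (a \<otimes>\<^bsub>A\<^esub> b) t"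
    using module_axioms module_axioms assms by (induction rule: tensor_induct) (simp_all add: a b)
  show "right_action R A (right_action R A t a) b = right_action R A t (a \<otimes>\<^bsub>A\<^esub> b)"
    using module_axioms module_axioms assms by (induction rule: tensor_induct) (simp_all add: a b)
  show "left_action R A a (right_action R A t b) = right_action R A (left_action R A a t) b"
    using module_axioms module_axioms assms by (induction rule: tensor_induct) (simp_all add: a b)
qed

end

text \<open>An infinitesimal unitary bialgebra without coassociativity, which can thus be studied
  element by element.\<close>

locale derivation_coproduct = unitary_algebra R A for R (structure) and A (structure) +
  fixes \<Delta>
  assumes coproduct_linear: "linear_map R A (tensor R A A) \<Delta>"
    and coproduct_mult: "\<lbrakk>a \<in> carrier A; b \<in> carrier A\<rbrakk> \<Longrightarrow>
      \<Delta> (a \<otimes>\<^bsub>A\<^esub> b) = left_action R A a (\<Delta> b) \<oplus>\<^bsub>tensor R A A\<^esub> right_action R A (\<Delta> a) b"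
begin

abbreviation square where "square \<equiv> tensor R A A"
abbreviation cube where "cube \<equiv> tensor R A square"

lemmas module_cube = module_tensor[OF module_axioms module_square]
lemmas cube_bilinear = pure_tensor_bilinear[OF module_axioms module_square]

lemmas square_induct [consumes 1, case_names pure add] = tensor_induct[OF module_axioms module_axioms]

text \<open>The tensor \<open>t \<otimes> y\<close>, rebracketed so that it lies in
  \<open>cube\<close>.\<close>

definition attach where "attach t y = tensor_assoc R A A A (pure_tensor R square A t y)"

text \<open>This and \<open>coproduct_right\<close> are the two sides of the axiom
  \<open>coassoc\<close>, as functions of the tensor \<open>\<Delta> c\<close>.\<close>

definition coproduct_left where
  "coproduct_left t = tensor_assoc R A A A (tensor_map R square A \<Delta> (\<lambda>x. x) t)"

definition coproduct_right where "coproduct_right = tensor_map R A square (\<lambda>x. x) \<Delta>"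

text \<open>Building the operation from the left action makes it well defined and linear in
  \<open>s\<close> by functoriality; additivity in \<open>t\<close> has to be shown
  separately.\<close>

definition join (infixl \<open>\<star>\<close> 70) where "s \<star> t = tensor_map R A square (\<lambda>x. x) (\<lambda>v. left_action R A v t) s"

lemma attach_bilinear: "bilinear_map R square A cube attach"
  unfolding attach_def
  by (rule bilinear_map_postcomp[OF pure_tensor_bilinear tensor_assoc_linear])
    (simp_all add: module_axioms module_square)

lemma attach_pure:
  "\<lbrakk>x \<in> carrier A; y \<in> carrier A; z \<in> carrier A\<rbrakk>
    \<Longrightarrow> attach (pure_tensor R A A x y) z = pure_tensor R A square x (pure_tensor R A A y z)"
  unfolding attach_def by (rule tensor_assoc_pure[OF module_axioms module_axioms module_axioms])

lemma coproduct_closed: "a \<in> carrier A \<Longrightarrow> \<Delta> a \<in> carrier square"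
  by (rule linear_map_closed[OF coproduct_linear])

lemma coproduct_left_linear: "linear_map R square cube coproduct_left"
  unfolding coproduct_left_def
  by (rule linear_map_comp[OF tensor_map_linear tensor_assoc_linear])
    (simp_all add: module_axioms module_square coproduct_linear linear_map_id)

lemma coproduct_left_pure:
  "\<lbrakk>x \<in> carrier A; y \<in> carrier A\<rbrakk> \<Longrightarrow> coproduct_left (pure_tensor R A A x y) = attach (\<Delta> x) y"
  unfolding coproduct_left_def attach_def
  by (simp add: tensor_map_pure module_axioms module_square coproduct_linear linear_map_id)

lemma coproduct_right_linear: "linear_map R square cube coproduct_right"
  unfolding coproduct_right_def
  by (rule tensor_map_linear)
    (simp_all add: module_axioms module_square coproduct_linear linear_map_id)

lemma coproduct_right_pure:
  "\<lbrakk>x \<in> carrier A; y \<in> carrier A\<rbrakk>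
    \<Longrightarrow> coproduct_right (pure_tensor R A A x y) = pure_tensor R A square x (\<Delta> y)"
  unfolding coproduct_right_def
  by (simp add: tensor_map_pure module_axioms module_square coproduct_linear linear_map_id)

lemma join_linear: "t \<in> carrier square \<Longrightarrow> linear_map R square cube (\<lambda>s. s \<star> t)"
  unfolding join_def
  by (rule tensor_map_linear)
    (simp_all add: module_axioms module_square bilinear_map_left[OF left_action_bilinear] linear_map_id)

lemma join_pure:
  "\<lbrakk>x \<in> carrier A; y \<in> carrier A; t \<in> carrier square\<rbrakk>
    \<Longrightarrow> pure_tensor R A A x y \<star> t = pure_tensor R A square x (left_action R A y t)"
  unfolding join_def
  by (simp add: tensor_map_pure module_axioms module_square bilinear_map_left[OF left_action_bilinear]
      linear_map_id)

abbreviation "left_cube a \<equiv> tensor_map R A square (\<lambda>x. a \<otimes>\<^bsub>A\<^esub> x) (\<lambda>t. t)"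
text \<open>One construction serves twice: with right multiplication by \<open>b\<close> it is the
  right action on \<open>cube\<close>, and with the grafting map it is the recursive part of the
  cocycle equation.\<close>

abbreviation "map_third f \<equiv> tensor_map R A square (\<lambda>x. x) (tensor_map R A A (\<lambda>x. x) f)"

lemma left_cube_linear: "a \<in> carrier A \<Longrightarrow> linear_map R cube cube (left_cube a)"
  by (rule tensor_map_linear)
    (simp_all add: module_axioms module_square mult_left_linear linear_map_id)

lemma left_cube_pure:
  "\<lbrakk>a \<in> carrier A; x \<in> carrier A; t \<in> carrier square\<rbrakk>
    \<Longrightarrow> left_cube a (pure_tensor R A square x t) = pure_tensor R A square (a \<otimes>\<^bsub>A\<^esub> x) t"
  by (rule tensor_map_pure)
    (simp_all add: module_axioms module_square mult_left_linear linear_map_id)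

lemma map_second_linear: "linear_map R A A f \<Longrightarrow> linear_map R square square (tensor_map R A A (\<lambda>x. x) f)"
  by (rule tensor_map_linear) (simp_all add: module_axioms linear_map_id)

lemma map_second_pure:
  "\<lbrakk>linear_map R A A f; x \<in> carrier A; y \<in> carrier A\<rbrakk>
    \<Longrightarrow> tensor_map R A A (\<lambda>x. x) f (pure_tensor R A A x y) = pure_tensor R A A x (f y)"
  by (rule tensor_map_pure) (simp_all add: module_axioms linear_map_id)

lemma map_third_linear: "linear_map R A A f \<Longrightarrow> linear_map R cube cube (map_third f)"
  by (rule tensor_map_linear) (simp_all add: module_axioms module_square map_second_linear linear_map_id)

lemma map_third_pure:
  "\<lbrakk>linear_map R A A f; x \<in> carrier A; t \<in> carrier square\<rbrakk>
    \<Longrightarrow> map_third f (pure_tensor R A square x t) = pure_tensor R A square x (tensor_map R A A (\<lambda>x. x) f t)"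
  by (rule tensor_map_pure) (simp_all add: module_axioms module_square map_second_linear linear_map_id)

text \<open>The identities below compare additive maps. With these three collections, induction on
  tensors leaves only a check on pure tensors.\<close>

lemmas additive =
  linear_map_add[OF left_action_linear] linear_map_add[OF right_action_linear]
  linear_map_add[OF bilinear_map_left[OF left_action_bilinear]]
  linear_map_add[OF bilinear_map_left[OF attach_bilinear]]
  linear_map_add[OF coproduct_left_linear] linear_map_add[OF coproduct_right_linear]
  linear_map_add[OF join_linear] linear_map_add[OF left_cube_linear]
  linear_map_add[OF map_second_linear] linear_map_add[OF map_third_linear]
  linear_map_add[OF bilinear_map_right[OF cube_bilinear]]

lemmas closed =
  coproduct_closed left_action_closed right_action_closed bilinear_map_closed[OF attach_bilinear]
  linear_map_closed[OF coproduct_left_linear] linear_map_closed[OF coproduct_right_linear]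
  linear_map_closed[OF join_linear] linear_map_closed[OF left_cube_linear]
  linear_map_closed[OF map_second_linear] linear_map_closed[OF map_third_linear]
  bilinear_map_closed[OF pure_bilinear] bilinear_map_closed[OF cube_bilinear]

lemmas pure =
  left_action_pure right_action_pure attach_pure coproduct_left_pure coproduct_right_pure
  join_pure left_cube_pure map_second_pure map_third_pure

lemma attach_left_action:
  assumes "t \<in> carrier square" "a \<in> carrier A" "y \<in> carrier A"
  shows "attach (left_action R A a t) y = left_cube a (attach t y)"
  using assms by (induction rule: square_induct) (simp_all add: pure additive closed)

text \<open>On \<open>t = u \<otimes> v\<close> both sides are
  \<open>u \<otimes> (v x \<otimes> y)\<close>. This is how the mixed term arises in the left
  iterated coproduct.\<close>

lemma attach_right_action:
  assumes "t \<in> carrier square" "x \<in> carrier A" "y \<in> carrier A"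
  shows "attach (right_action R A t x) y = t \<star> pure_tensor R A A x y"
  using assms by (induction rule: square_induct) (simp_all add: pure additive closed)

lemma attach_map:
  assumes "t \<in> carrier square" "linear_map R A A f" "y \<in> carrier A"
  shows "attach t (f y) = map_third f (attach t y)"
  using assms
  by (induction rule: square_induct) (simp_all add: pure additive closed linear_map_closed[OF assms(2)])

lemma join_add:
  assumes "s \<in> carrier square" "t \<in> carrier square" "t' \<in> carrier square"
  shows "s \<star> (t \<oplus>\<^bsub>square\<^esub> t') = s \<star> t \<oplus>\<^bsub>cube\<^esub> s \<star> t'"
proof -
  interpret S: module R square by (rule module_square)
  interpret C: module R cube by (rule module_cube)
  show ?thesis
    using assms by (induction rule: square_induct) (simp_all add: pure additive closed C.a_ac)
qed

text \<open>On \<open>t = x \<otimes> y\<close> the derivation rule splits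
  \<open>\<Delta> (a x)\<close> into \<open>a \<cdot> \<Delta> x\<close> and
  \<open>\<Delta> a \<cdot> x\<close>; attaching \<open>y\<close> turns the second part into
  \<open>\<Delta> a \<star> t\<close>.\<close>

lemma coproduct_left_left_action:
  assumes "t \<in> carrier square" "a \<in> carrier A"
  shows "coproduct_left (left_action R A a t) = left_cube a (coproduct_left t) \<oplus>\<^bsub>cube\<^esub> \<Delta> a \<star> t"
proof -
  interpret S: module R square by (rule module_square)
  interpret C: module R cube by (rule module_cube)
  show ?thesis
    using assms
    by (induction rule: square_induct)
      (simp_all add: pure additive closed C.a_ac coproduct_mult attach_left_action attach_right_action
        join_add)
qed

text \<open>Here \<open>\<Delta>\<close> acts on the first factor and \<open>f\<close> on the
  second, so they do not interfere.\<close>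

lemma coproduct_left_map:
  assumes "t \<in> carrier square" "linear_map R A A f"
  shows "coproduct_left (tensor_map R A A (\<lambda>x. x) f t) = map_third f (coproduct_left t)"
  using assms
  by (induction rule: square_induct)
    (simp_all add: pure additive closed linear_map_closed[OF assms(2)] attach_map)

lemma coproduct_right_left_action:
  assumes "t \<in> carrier square" "a \<in> carrier A"
  shows "coproduct_right (left_action R A a t) = left_cube a (coproduct_right t)"
  using assms by (induction rule: square_induct) (simp_all add: pure additive closed)

text \<open>On \<open>t = x \<otimes> y\<close> the factor \<open>\<Delta> (y b)\<close> splits into
  \<open>y \<cdot> \<Delta> b\<close>, which gives the join, and
  \<open>\<Delta> y \<cdot> b\<close>, which is multiplication in the third factor.\<close>

lemma coproduct_right_right_action:
  assumes "t \<in> carrier square" "b \<in> carrier A"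
  shows "coproduct_right (right_action R A t b)
    = t \<star> \<Delta> b \<oplus>\<^bsub>cube\<^esub> map_third (\<lambda>c. c \<otimes>\<^bsub>A\<^esub> b) (coproduct_right t)"
proof -
  interpret S: module R square by (rule module_square)
  interpret C: module R cube by (rule module_cube)
  note mult_right_linear[OF assms(2), simp]
  show ?thesis
    using assms
    by (induction rule: square_induct)
      (simp_all add: pure additive closed C.a_ac coproduct_mult right_action_def[symmetric])
qed

text \<open>The left side expands to \<open>(p + \<Delta> a \<star> \<Delta> b) + q\<close> and the
  right side to \<open>p + (\<Delta> a \<star> \<Delta> b + q)\<close>, where the hypotheses on
  \<open>b\<close> and \<open>a\<close> identify the two versions of \<open>p\<close> and of
  \<open>q\<close>.\<close>

lemma coassoc_mult:
  assumes "a \<in> carrier A" "b \<in> carrier A"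
    and "coproduct_left (\<Delta> a) = coproduct_right (\<Delta> a)" "coproduct_left (\<Delta> b) = coproduct_right (\<Delta> b)"
  shows "coproduct_left (\<Delta> (a \<otimes>\<^bsub>A\<^esub> b)) = coproduct_right (\<Delta> (a \<otimes>\<^bsub>A\<^esub> b))"
proof -
  interpret C: module R cube by (rule module_cube)
  note [simp] = mult_right_linear[OF assms(2)]
  have "coproduct_left (right_action R A (\<Delta> a) b)
      = map_third (\<lambda>c. c \<otimes>\<^bsub>A\<^esub> b) (coproduct_right (\<Delta> a))"
    using assms by (simp add: right_action_def coproduct_left_map closed)
  then show ?thesis
    using assms
    by (simp add: coproduct_mult additive closed coproduct_left_left_action
        coproduct_right_left_action coproduct_right_right_action C.a_assoc)
qed

text \<open>The derivation rule at \<open>1 = 1 1\<close> reads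
  \<open>\<Delta> 1 = \<Delta> 1 + \<Delta> 1\<close>.\<close>

lemma coproduct_one: "\<Delta> \<one>\<^bsub>A\<^esub> = \<zero>\<^bsub>square\<^esub>"
proof -
  interpret S: module R square by (rule module_square)
  have "\<Delta> \<one>\<^bsub>A\<^esub> \<oplus>\<^bsub>square\<^esub> \<Delta> \<one>\<^bsub>A\<^esub> = \<Delta> \<one>\<^bsub>A\<^esub>"
    using coproduct_mult[of "\<one>\<^bsub>A\<^esub>" "\<one>\<^bsub>A\<^esub>"] by (simp add: left_action_one right_action_one closed)
  then show ?thesis using S.add.r_cancel_one' closed(1)[OF one_closed] by metis
qed

text \<open>Both sides contain \<open>\<Delta> c \<otimes> 1\<close>, from different sources: on the
  left it comes from the summand \<open>c \<otimes> 1\<close>, on the right from the cocycle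
  equation used once more in the second factor. The remaining terms are \<open>map_third B\<close>
  of the two sides for \<open>c\<close>.\<close>

lemma coassoc_graft:
  assumes B: "linear_map R A A B"
    and cocycle: "\<And>a. a \<in> carrier A \<Longrightarrow> \<Delta> (B a)
      = pure_tensor R A A a \<one>\<^bsub>A\<^esub> \<oplus>\<^bsub>square\<^esub> tensor_map R A A (\<lambda>x. x) B (\<Delta> a)"
    and c: "c \<in> carrier A" "coproduct_left (\<Delta> c) = coproduct_right (\<Delta> c)"
  shows "coproduct_left (\<Delta> (B c)) = coproduct_right (\<Delta> (B c))"
proof -
  interpret S: module R square by (rule module_square)
  interpret C: module R cube by (rule module_cube)
  note [simp] = B linear_map_closed[OF B]
  \<comment> \<open>The claim is made for all \<open>t\<close>, since the induction breaks up
    \<open>\<Delta> c\<close>; on \<open>x \<otimes> y\<close> it is the cocycle equation at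
    \<open>y\<close>.\<close>
  have right: "coproduct_right (tensor_map R A A (\<lambda>x. x) B t)
      = attach t \<one>\<^bsub>A\<^esub> \<oplus>\<^bsub>cube\<^esub> map_third B (coproduct_right t)" if "t \<in> carrier square" for t
    using that
    by (induction rule: square_induct) (simp_all add: pure additive closed cocycle C.a_ac)
  \<comment> \<open>The summand \<open>c \<otimes> 1\<close> contributes
    \<open>c \<otimes> \<Delta> 1\<close> on the right, which vanishes.\<close>
  have "pure_tensor R A square c \<zero>\<^bsub>square\<^esub> = \<zero>\<^bsub>cube\<^esub>"
    using linear_map_zero[OF module_square module_cube bilinear_map_right[OF cube_bilinear c(1)]] .
  then show ?thesis
    using c by (simp add: cocycle pure additive closed right coproduct_one coproduct_left_map)
qed

lemma infinitesimal_unitary_bialgebraI: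
  assumes "\<And>c. c \<in> carrier A \<Longrightarrow> coproduct_left (\<Delta> c) = coproduct_right (\<Delta> c)"
  shows "infinitesimal_unitary_bialgebra R A \<Delta>"
  by unfold_locales
    (use assms in \<open>simp_all add: coproduct_left_def coproduct_right_def coproduct_linear coproduct_mult\<close>)

end

section \<open>The algebra of leaf-decorated forests\<close>

lemma Nil_leaf_forests: "[] \<in> leaf_forests X \<sigma>"
  and Cons_leaf_forests:
    "T # u \<in> leaf_forests X \<sigma> \<longleftrightarrow> leaf_tree X \<sigma> T \<and> u \<in> leaf_forests X \<sigma>"
  and append_leaf_forests:
    "u @ v \<in> leaf_forests X \<sigma> \<longleftrightarrow> u \<in> leaf_forests X \<sigma> \<and> v \<in> leaf_forests X \<sigma>"
  by (auto simp: leaf_forests_def)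

lemma leaf_tree_Node:
  "leaf_tree X \<sigma> (Node d ts) \<longleftrightarrow> (d = \<sigma> \<or> d \<in> X \<and> ts = []) \<and> ts \<in> leaf_forests X \<sigma>"
  by (auto simp: leaf_forests_def in_lists_conv_set)

text \<open>The defining equation would unfold the children into a statement about set members;
  \<open>leaf_tree_Node\<close> keeps them together as a forest, the form that the induction
  uses.\<close>

declare leaf_tree.simps [simp del]

lemmas leaf_forests_simps = Nil_leaf_forests Cons_leaf_forests append_leaf_forests leaf_tree_Node

text \<open>The cases follow the recursion of \<open>coproduct_forest\<close>. A single leaf
  decorated by \<open>\<sigma>\<close> falls under \<open>graft\<close> with the empty forest. Total
  size decreases both from a tree to its children and from a forest to its first tree or its
  tail.\<close>

lemma leaf_forests_induct [consumes 1, case_names Nil leaf graft Cons]: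
  assumes "u \<in> leaf_forests X \<sigma>"
    and Nil: "P []"
    and leaf: "\<And>x. x \<in> X \<Longrightarrow> P [Node x []]"
    and graft: "\<And>ts. ts \<in> leaf_forests X \<sigma> \<Longrightarrow> P ts \<Longrightarrow> P [Node \<sigma> ts]"
    and Cons: "\<And>T T' Ts. leaf_tree X \<sigma> T \<Longrightarrow> T' # Ts \<in> leaf_forests X \<sigma> \<Longrightarrow>
      P [T] \<Longrightarrow> P (T' # Ts) \<Longrightarrow> P (T # T' # Ts)"
  shows "P u"
  using assms(1)
proof (induction u rule: measure_induct_rule[where f = "size_list size"])
  case (less u)
  show ?case
  proof (cases u)
    case Nil
    then show ?thesis using assms(2) by simp
  next
    case (Cons T Ts)
    then show ?thesis
    proof (cases Ts)
      case Nil
      with Cons show ?thesis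
        using less leaf graft by (cases T) (auto simp: leaf_forests_simps)
    next
      case (Cons T' Ts')
      with \<open>u = T # Ts\<close> show ?thesis
        using less by (auto simp: leaf_forests_simps intro!: assms(5))
    qed
  qed
qed

text \<open>The module axioms speak of carrier, addition, zero and scalars; the fields for product
  and unit are free to receive concatenation.\<close>

lemma module_update:
  assumes "module R M"
  shows "module R (M\<lparr>mult := m, one := e\<rparr>)"
  using assms
  by (simp add: module_def module_axioms_def abelian_group_def abelian_group_axioms_def abelian_monoid_def)

lemma carrier_H_leaf: "carrier (H_leaf R X \<sigma>) = carrier (free_module R (leaf_forests X \<sigma>))"
  and zero_H_leaf: "zero (H_leaf R X \<sigma>) = zero (free_module R (leaf_forests X \<sigma>))"
  and add_H_leaf: "add (H_leaf R X \<sigma>) = add (free_module R (leaf_forests X \<sigma>))"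
  and smult_H_leaf: "smult (H_leaf R X \<sigma>) = smult (free_module R (leaf_forests X \<sigma>))"
  and one_H_leaf: "\<one>\<^bsub>H_leaf R X \<sigma>\<^esub> = basis_elt R []"
  by (simp_all add: H_leaf_def Let_def)

lemma linear_map_H_leaf_left:
  "linear_map R (H_leaf R X \<sigma>) M f \<longleftrightarrow> linear_map R (free_module R (leaf_forests X \<sigma>)) M f"
  and linear_map_H_leaf_right:
  "linear_map R M (H_leaf R X \<sigma>) g \<longleftrightarrow> linear_map R M (free_module R (leaf_forests X \<sigma>)) g"
  by (simp_all add: linear_map_def carrier_H_leaf add_H_leaf smult_H_leaf)

context
  fixes R :: "('r, 'z) ring_scheme" and X :: "'d set" and \<sigma> :: 'd
  assumes R: "cring R"
begin

private abbreviation (input) "H \<equiv> H_leaf R X \<sigma>"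
private abbreviation (input) "e \<equiv> basis_elt R :: 'd ptree list \<Rightarrow> _"

lemma module_H_leaf: "module R H"
  unfolding H_leaf_def Let_def by (rule module_update[OF module_free_module[OF R]])

lemma basis_H_leaf: "u \<in> leaf_forests X \<sigma> \<Longrightarrow> e u \<in> carrier H"
  by (simp add: carrier_H_leaf basis_elt_closed[OF R])

lemma H_leaf_induct [consumes 1, case_names basis add]:
  assumes "f \<in> carrier H"
    and basis: "\<And>r u. r \<in> carrier R \<Longrightarrow> u \<in> leaf_forests X \<sigma> \<Longrightarrow> Q (r \<odot>\<^bsub>H\<^esub> e u)"
    and add: "\<And>f g. f \<in> carrier H \<Longrightarrow> g \<in> carrier H \<Longrightarrow> Q f \<Longrightarrow> Q g \<Longrightarrow> Q (f \<oplus>\<^bsub>H\<^esub> g)"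
  shows "Q f"
proof -
  interpret H: module R H by (rule module_H_leaf)
  have "\<zero>\<^bsub>H\<^esub> = \<zero>\<^bsub>R\<^esub> \<odot>\<^bsub>H\<^esub> e []"
    by (simp add: basis_H_leaf Nil_leaf_forests)
  then have "Q \<zero>\<^bsub>H\<^esub>"
    using basis[OF H.R.zero_closed Nil_leaf_forests] by simp
  with R assms(1)[unfolded carrier_H_leaf] show ?thesis
    using basis add
    unfolding carrier_H_leaf add_H_leaf smult_H_leaf zero_H_leaf
    by (rule free_module_induct)
qed

lemma mult_H_leaf_bilinear: "bilinear_map R H H H (mult H)"
proof -
  let ?F = "free_module R (leaf_forests X \<sigma>)"
  have "bilinear_map R ?F ?F ?F (\<lambda>f g. linear_ext R ?F (\<lambda>u. linear_ext R ?F (\<lambda>v. e (u @ v)) g) f)"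
    by (rule linear_ext_bilinear)
      (simp_all add: module_free_module[OF R] basis_elt_closed[OF R] leaf_forests_simps)
  \<comment> \<open>Linearity sees only carrier, addition and scalars, which \<open>H\<close> shares
    with the free module.\<close>
  then have "bilinear_map R H H H (\<lambda>f g. linear_ext R ?F (\<lambda>u. linear_ext R ?F (\<lambda>v. e (u @ v)) g) f)"
    by (simp add: bilinear_map_def linear_map_H_leaf_left linear_map_H_leaf_right carrier_H_leaf)
  then show ?thesis by (simp add: H_leaf_def Let_def)
qed

lemma mult_basis_H_leaf:
  assumes "u \<in> leaf_forests X \<sigma>" "v \<in> leaf_forests X \<sigma>"
  shows "e u \<otimes>\<^bsub>H\<^esub> e v = e (u @ v)"
  using assms
  by (simp add: H_leaf_def Let_def linear_ext_basis module_free_module[OF R] basis_elt_closed[OF R]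
      leaf_forests_simps)

lemma unitary_algebra_H_leaf: "unitary_algebra R H"
proof -
  interpret H: module R H by (rule module_H_leaf)
  note bil = mult_H_leaf_bilinear
  note [simp] = bilinear_map_closed[OF bil] basis_H_leaf mult_basis_H_leaf leaf_forests_simps
    linear_map_add[OF bilinear_map_left[OF bil]] linear_map_add[OF bilinear_map_right[OF bil]]
    linear_map_smult[OF bilinear_map_left[OF bil]] linear_map_smult[OF bilinear_map_right[OF bil]]
  have one: "\<one>\<^bsub>H\<^esub> \<in> carrier H" by (simp add: one_H_leaf)
  have l_one: "\<one>\<^bsub>H\<^esub> \<otimes>\<^bsub>H\<^esub> x = x" if "x \<in> carrier H" for x
    using that by (induction rule: H_leaf_induct) (simp_all add: one_H_leaf)
  have r_one: "x \<otimes>\<^bsub>H\<^esub> \<one>\<^bsub>H\<^esub> = x" if "x \<in> carrier H" for x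
    using that by (induction rule: H_leaf_induct) (simp_all add: one_H_leaf)
  \<comment> \<open>Associativity is freed from basis elements one variable at a time, from right to
    left; on three forests it is associativity of \<open>@\<close>.\<close>
  have assoc3: "(e u \<otimes>\<^bsub>H\<^esub> e v) \<otimes>\<^bsub>H\<^esub> z = e u \<otimes>\<^bsub>H\<^esub> (e v \<otimes>\<^bsub>H\<^esub> z)"
    if "z \<in> carrier H" "u \<in> leaf_forests X \<sigma>" "v \<in> leaf_forests X \<sigma>" for u v z
    using that by (induction rule: H_leaf_induct) simp_all
  \<comment> \<open>Evaluating the product of two basis elements would destroy the pattern of
    \<open>assoc3\<close>, hence the deletion from the simpset.\<close>
  have assoc2: "(e u \<otimes>\<^bsub>H\<^esub> y) \<otimes>\<^bsub>H\<^esub> z = e u \<otimes>\<^bsub>H\<^esub> (y \<otimes>\<^bsub>H\<^esub> z)"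
    if "y \<in> carrier H" "z \<in> carrier H" "u \<in> leaf_forests X \<sigma>" for u y z
    using that by (induction rule: H_leaf_induct) (simp_all add: assoc3 del: mult_basis_H_leaf)
  have assoc: "(x \<otimes>\<^bsub>H\<^esub> y) \<otimes>\<^bsub>H\<^esub> z = x \<otimes>\<^bsub>H\<^esub> (y \<otimes>\<^bsub>H\<^esub> z)"
    if "x \<in> carrier H" "y \<in> carrier H" "z \<in> carrier H" for x y z
    using that by (induction rule: H_leaf_induct) (simp_all add: assoc2)
  have "monoid H" by (rule monoidI) (simp_all add: one l_one r_one assoc)
  then have "ring H" by (intro ringI H.abelian_group_axioms) simp_all
  then show ?thesis
    by (intro unitary_algebra.intro unitary_algebra_axioms.intro module_H_leaf) simp_all
qed

lemma graft_linear: "linear_map R H H (graft R X \<sigma>)"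
  unfolding graft_def linear_map_H_leaf_left
  by (rule linear_ext_linear) (simp_all add: module_H_leaf basis_H_leaf leaf_forests_simps)

lemma graft_basis: "u \<in> leaf_forests X \<sigma> \<Longrightarrow> graft R X \<sigma> (e u) = e [Node \<sigma> u]"
  unfolding graft_def
  by (rule linear_ext_basis) (simp_all add: module_H_leaf basis_H_leaf leaf_forests_simps)

section \<open>The coproduct on forests: derivation rule, cocycle equation, coassociativity\<close>

interpretation H: unitary_algebra R H by (rule unitary_algebra_H_leaf)

lemma coproduct_forest_closed:
  assumes "u \<in> leaf_forests X \<sigma>"
  shows "coproduct_forest R X \<sigma> u \<in> carrier (tensor R H H)"
proof -
  interpret S: module R "tensor R H H" by (rule H.module_square)
  note [simp] = basis_H_leaf leaf_forests_simps pure_tensor_closed[OF module_H_leaf module_H_leaf]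
    linear_map_closed[OF H.left_action_linear] linear_map_closed[OF H.right_action_linear]
    linear_map_closed[OF tensor_map_linear[OF module_H_leaf module_H_leaf module_H_leaf module_H_leaf
      linear_map_id graft_linear]]
  show ?thesis
    using assms
    by (induction rule: leaf_forests_induct) (simp_all add: Let_def H.one_closed)
qed

lemma coproduct_eps_linear: "linear_map R H (tensor R H H) (coproduct_eps R X \<sigma>)"
  unfolding coproduct_eps_def linear_map_H_leaf_left
  by (rule linear_ext_linear) (simp_all add: H.module_square coproduct_forest_closed)

lemma coproduct_eps_basis:
  "u \<in> leaf_forests X \<sigma> \<Longrightarrow> coproduct_eps R X \<sigma> (e u) = coproduct_forest R X \<sigma> u"
  unfolding coproduct_eps_def
  by (rule linear_ext_basis) (simp_all add: H.module_square coproduct_forest_closed)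

text \<open>The recursion states this for a nonempty tail. It persists for the empty one because the
  coproduct of \<open>[]\<close> is zero and \<open>e []\<close> is the unit, which acts
  trivially.\<close>

lemma coproduct_forest_Cons:
  assumes "leaf_tree X \<sigma> T" "u \<in> leaf_forests X \<sigma>"
  shows "coproduct_forest R X \<sigma> (T # u) = left_action R H (e [T]) (coproduct_forest R X \<sigma> u)
    \<oplus>\<^bsub>tensor R H H\<^esub> right_action R H (coproduct_forest R X \<sigma> [T]) (e u)"
proof (cases u)
  case Nil
  interpret S: module R "tensor R H H" by (rule H.module_square)
  have "left_action R H (e [T]) \<zero>\<^bsub>tensor R H H\<^esub> = \<zero>\<^bsub>tensor R H H\<^esub>"
    using assms
    by (intro linear_map_zero[OF H.module_square H.module_square H.left_action_linear] basis_H_leaf)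
      (simp add: leaf_forests_simps)
  moreover have "coproduct_forest R X \<sigma> [T] \<in> carrier (tensor R H H)"
    using assms by (intro coproduct_forest_closed) (simp add: leaf_forests_simps)
  ultimately show ?thesis
    using Nil H.right_action_one by (simp add: one_H_leaf)
qed (simp add: Let_def)

text \<open>The recursion splits off one tree; the bimodule laws allow the cut to be moved to any
  place. In the inductive step both sides become \<open>(T u) \<cdot> \<Delta> v + T \<cdot>
  \<Delta> u \<cdot> v + \<Delta> T \<cdot> (u v)\<close>.\<close>

lemma coproduct_forest_append:
  assumes "u \<in> leaf_forests X \<sigma>" "v \<in> leaf_forests X \<sigma>"
  shows "coproduct_forest R X \<sigma> (u @ v) = left_action R H (e u) (coproduct_forest R X \<sigma> v)
    \<oplus>\<^bsub>tensor R H H\<^esub> right_action R H (coproduct_forest R X \<sigma> u) (e v)"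
  using assms
proof (induction u)
  case Nil
  interpret S: module R "tensor R H H" by (rule H.module_square)
  have "right_action R H \<zero>\<^bsub>tensor R H H\<^esub> (e v) = \<zero>\<^bsub>tensor R H H\<^esub>"
    using Nil by (intro linear_map_zero[OF H.module_square H.module_square H.right_action_linear] basis_H_leaf)
  then show ?case
    using Nil H.left_action_one coproduct_forest_closed by (simp add: one_H_leaf)
next
  case (Cons T u)
  interpret S: module R "tensor R H H" by (rule H.module_square)
  note [simp] = basis_H_leaf leaf_forests_simps coproduct_forest_closed
    H.left_action_closed H.right_action_closed
  from Cons show ?case
    by (simp add: coproduct_forest_Cons[of T "u @ v"] coproduct_forest_Cons[of T u]
        linear_map_add[OF H.left_action_linear] linear_map_add[OF H.right_action_linear]
        H.left_action_mult H.right_action_mult H.left_right_action mult_basis_H_leaf S.a_assoc)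
qed

lemma derivation_coproduct_H_leaf: "derivation_coproduct R H (coproduct_eps R X \<sigma>)"
proof (intro derivation_coproduct.intro derivation_coproduct_axioms.intro
    unitary_algebra_H_leaf coproduct_eps_linear)
  interpret S: module R "tensor R H H" by (rule H.module_square)
  let ?D = "coproduct_eps R X \<sigma>"
  note bil = mult_H_leaf_bilinear and la = H.left_action_bilinear and ra = H.right_action_bilinear
  note [simp] = basis_H_leaf leaf_forests_simps linear_map_closed[OF coproduct_eps_linear]
    H.left_action_closed H.right_action_closed H.smult_closed
  note maps = bilinear_map_left[OF bil] bilinear_map_right[OF bil] bilinear_map_left[OF la]
    bilinear_map_right[OF la] bilinear_map_left[OF ra] bilinear_map_right[OF ra] coproduct_eps_linear
  note [simp] = maps[THEN linear_map_add] maps[THEN linear_map_smult]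
  \<comment> \<open>Both sides are bilinear; the right argument is freed first, with a forest on the
    left, and then the left one.\<close>
  have basis: "?D (e u \<otimes>\<^bsub>H\<^esub> b)
      = left_action R H (e u) (?D b) \<oplus>\<^bsub>tensor R H H\<^esub> right_action R H (?D (e u)) b"
    if "b \<in> carrier H" "u \<in> leaf_forests X \<sigma>" for b u
    using that
    by (induction rule: H_leaf_induct)
      (simp_all add: mult_basis_H_leaf coproduct_eps_basis coproduct_forest_append
        coproduct_forest_closed S.smult_r_distr S.a_ac)
  fix a b assume "a \<in> carrier H" "b \<in> carrier H"
  then show "?D (a \<otimes>\<^bsub>H\<^esub> b) = left_action R H a (?D b) \<oplus>\<^bsub>tensor R H H\<^esub> right_action R H (?D a) b"
    by (induction rule: H_leaf_induct) (simp_all add: basis S.smult_r_distr S.a_ac)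
qed

interpretation D: derivation_coproduct R H "coproduct_eps R X \<sigma>"
  by (rule derivation_coproduct_H_leaf)

text \<open>Since \<open>coproduct_forest\<close> tests the root for membership in \<open>X\<close>
  first, \<open>\<sigma> \<notin> X\<close> is what sends \<open>Node \<sigma> ts\<close> to the
  grafting branch. All terms are linear in \<open>a\<close>, so forests suffice.\<close>

lemma coproduct_eps_graft:
  assumes "\<sigma> \<notin> X" "a \<in> carrier H"
  shows "coproduct_eps R X \<sigma> (graft R X \<sigma> a) = pure_tensor R H H a \<one>\<^bsub>H\<^esub>
    \<oplus>\<^bsub>tensor R H H\<^esub> tensor_map R H H (\<lambda>f. f) (graft R X \<sigma>) (coproduct_eps R X \<sigma> a)"
proof -
  interpret S: module R "tensor R H H" by (rule H.module_square)
  note maps = coproduct_eps_linear graft_linear D.map_second_linear[OF graft_linear]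
    bilinear_map_left[OF H.pure_bilinear H.one_closed]
  note [simp] = basis_H_leaf leaf_forests_simps H.smult_closed
    maps[THEN linear_map_closed] maps[THEN linear_map_add] maps[THEN linear_map_smult]
  show ?thesis
    using assms(2)
    by (induction rule: H_leaf_induct)
      (simp_all add: graft_basis coproduct_eps_basis coproduct_forest_closed assms(1) Let_def
        S.smult_r_distr S.a_ac)
qed

lemma coassoc_basis:
  assumes "\<sigma> \<notin> X" "u \<in> leaf_forests X \<sigma>"
  shows "D.coproduct_left (coproduct_eps R X \<sigma> (e u)) = D.coproduct_right (coproduct_eps R X \<sigma> (e u))"
  using assms(2)
proof (induction rule: leaf_forests_induct)
  case Nil
  then show ?case
    using D.coproduct_one linear_map_zero[OF H.module_square D.module_cube D.coproduct_left_linear]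
      linear_map_zero[OF H.module_square D.module_cube D.coproduct_right_linear]
    by (simp add: one_H_leaf)
next
  case (leaf x)
  \<comment> \<open>The iterated coproducts of a leaf are \<open>\<Delta> 1 \<otimes> 1\<close> and
    \<open>1 \<otimes> \<Delta> 1\<close>, both zero.\<close>
  then have "coproduct_eps R X \<sigma> (e [Node x []]) = pure_tensor R H H \<one>\<^bsub>H\<^esub> \<one>\<^bsub>H\<^esub>"
    by (simp add: coproduct_eps_basis leaf_forests_simps Let_def)
  then show ?case
    using linear_map_zero[OF H.module_square D.module_cube bilinear_map_left[OF D.attach_bilinear H.one_closed]]
      linear_map_zero[OF H.module_square D.module_cube bilinear_map_right[OF D.cube_bilinear H.one_closed]]
    by (simp add: D.pure D.coproduct_one)
next
  case (graft ts)
  then show ?case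
    using D.coassoc_graft[OF graft_linear coproduct_eps_graft[OF assms(1)], of "e ts"]
    by (simp add: basis_H_leaf graft_basis)
next
  case (Cons T T' Ts)
  then show ?case
    using D.coassoc_mult[of "e [T]" "e (T' # Ts)"]
    by (simp add: basis_H_leaf mult_basis_H_leaf leaf_forests_simps)
qed

lemma infinitesimal_unitary_bialgebra_H_leaf:
  assumes "\<sigma> \<notin> X"
  shows "infinitesimal_unitary_bialgebra R H (coproduct_eps R X \<sigma>)"
proof (rule D.infinitesimal_unitary_bialgebraI)
  note maps = coproduct_eps_linear D.coproduct_left_linear D.coproduct_right_linear
  note [simp] = basis_H_leaf
    maps[THEN linear_map_closed] maps[THEN linear_map_add] maps[THEN linear_map_smult]
  fix c assume "c \<in> carrier H"
  then show "D.coproduct_left (coproduct_eps R X \<sigma> c) = D.coproduct_right (coproduct_eps R X \<sigma> c)"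
    by (induction rule: H_leaf_induct) (simp_all add: coassoc_basis[OF assms])
qed

end

theorem theorem2p15:
  fixes R :: "('r, 'z) ring_scheme" and X :: "'d set" and \<sigma> :: 'd
  assumes "cring R" and "\<sigma> \<notin> X"
  shows "infinitesimal_unitary_bialgebra R (H_leaf R X \<sigma>) (coproduct_eps R X \<sigma>)"
  using assms by (rule infinitesimal_unitary_bialgebra_H_leaf)

end
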